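(* In Situation 2 there exist infinitely many Nash equilibria, namely the vectors $(\hat\alpha,\hat\beta,\hat\gamma,\hat e,\hat m,\hat a)$ defined by $$\hat m\ge0,\quad\hat\beta=\frac v{u+v},\quad\hat e=(\varphi')^{-1}\Big(\frac{u+v}u\Big),\quad\hat\gamma=\frac1{g'(\hat m)},$$ $$\hat a\in\arg\max_{a\ge0}\big[F(a)-e^{-u\delta\psi(a)}B(\hat m)\big],$$ $$\hat\alpha=C(\hat\beta)+\hat e-\frac u{u+v}\delta\psi(\hat a)-G(\hat m),$$ and such that $C(\hat\beta)+\hat e-\frac u{u+v}\delta\psi(\hat a)-G(\hat m)\ge0$, a condition that is satisfied when $\hat m\le G^{-1}\big((\varphi')^{-1}(\frac{u+v}u)\big)$. Moreover $\hat\alpha+\hat\gamma>0$, and if $\delta\ge0$ then $\hat a$ is positive and unique for each $\hat m$. The corresponding optimal values for firms $J$ and $I$ are respectively $V(0)$ and $$\hat I^2(\hat m)=F(\hat a)-e^{-u\delta\psi(\hat a)}B(\hat m).$$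
   Context: Standing assumptions. $u,v>0$, $U(x)=-e^{-ux}$, $V(x)=-e^{-vx}$; $D>0$, $r_I\ge 0$, $\delta\in\mathbb R$, $x^+=\max(x,0)$. $\mu$ is a non-constant real random variable bounded from below by a finite constant $\underline\mu$, with $\mathbb E[e^{\lambda\mu}]<\infty$ for all $\lambda\in\mathbb R$. $\varphi,\psi:\mathbb R_+\to\mathbb R_+$ are $C^1$, increasing, strictly concave, $\varphi'(0)=\psi'(0)=+\infty$, $\varphi'(\infty)=\psi'(\infty)=0$, $\varphi(\infty)+\delta^+\psi(\infty)<\underline\mu$, and $(\varphi')^{-1}(x)\sim(\psi')^{-1}(x)$ as $x\to0$. $g:\mathbb R_+\to\mathbb R$ is $C^1$, increasing, strictly concave, $g'(0)=\infty$, $g'(\infty)=0$, and $m_0:=\inf\{m>0:g(m)>0\}<\infty$. $b^a,b^m,b^e:\mathbb R_+\to\mathbb R_+$ are $C^1$, increasing, concave; $(b^a)'(0)>0$ (possibly infinite), $(b^a)'(\infty)=0$, $b^a(\infty)<\infty$; $(b^m)'(0)=(b^e)'(0)=\infty$, $(b^m)'(\infty)=(b^e)'(\infty)=0$. $f:\mathbb R_+\to\mathbb R$ is differentiable, increasing, strictly convex, $f'(\infty)=\infty$. $F(a)=b^a(a)-f((1+r_I)(D+a))$, and it is assumed that $F'(0)>0$ (possibly infinite). (A function with infinite derivative at $0$ is continuous on $\mathbb R_+$ and $C^1$ on $(0,\infty)$.) Conventions: $(\phi')^{-1}(+\infty)=0$ for $\phi=\varphi,\psi,g$; $x/0=+\infty$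 for $x>0$; $1/g'(0)=0$, $g(0)/g'(0)=0$. Situation 2. Write $C^{op}=\mu-\varphi(e)-\delta\psi(a)$. Firm $J$ controls $(e,m)\in\mathbb R_+^2$ and firm $I$ controls $(a,\alpha,\beta,\gamma)\in\mathbb R_+\times\mathbb R_+\times\mathbb R\times\mathbb R_+$. The payoffs are $$J^2=\mathbb E\big[V\big(\alpha+(\beta-1)C^{op}-e+\gamma g(m)-m\big)\big],$$ $$I^2=\mathbb E\big[F(a)+U\big(b^m(m)+b^e(e)-\alpha-\beta C^{op}-\gamma g(m)\big)\big].$$ A Nash equilibrium is a vector $(\hat\alpha,\hat\beta,\hat\gamma,\hat e,\hat m,\hat a)$ such that $(\hat e,\hat m)$ maximizes $J^2$ over $\mathbb R_+^2$ given $(\hat a,\hat\alpha,\hat\beta,\hat\gamma)$, and $(\hat a,\hat\alpha,\hat\beta,\hat\gamma)$ maximizes $I^2$ over the $(a,\alpha,\beta,\gamma)\in\mathbb R_+\times\mathbb R_+\times\mathbb R\times\mathbb R_+$ satisfying $J^2\ge V(0)$, given $(\hat e,\hat m)$. Notation. $e^*(\beta)=(\varphi')^{-1}\big(\frac1{(1-\beta)^+}\big)$; $C(\beta)=\frac1v\ln\mathbb E\big[e^{v(1-\beta)(\mu-\varphi(e^*(\beta)))}\big]$; $G(m)=\frac{g(m)}{g'(m)}-m$, and $G^{-1}:[-m_0,\infty)\to[m_0,\infty)$ is the inverse of the increasing bijection $G|_{[m_0,\infty)}$; with $\mathrm{Id}$ the identity map, $$B(m)=e^{u(\mathrm{Id}-b^m)(m)}\,e^{u(\mathrm{Id}-b^e)(e^*(\frac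 v{u+v}))}\,e^{(u+v)C(\frac v{u+v})}.$$ *)

theory Defs
  imports "HOL-Probability.Probability" "HOL-Library.Landau_Symbols"
begin

section \<open>Functions on the half-line\<close>

text \<open>
  Functions on \<open>[0, \<infinity>)\<close> are represented by total functions \<open>real \<Rightarrow> real\<close> whose values at negative
  arguments are irrelevant. Their derivative is taken in \<open>ereal\<close>; at \<open>0\<close> it is the one-sided
  derivative, which may be infinite.
\<close>

definition ederiv :: "(real \<Rightarrow> real) \<Rightarrow> real \<Rightarrow> ereal" where
  "ederiv h x = (if 0 < x then ereal (deriv h x)
                 else Lim (at_right 0) (\<lambda>t. ereal ((h t - h 0) / t)))"

text \<open>
  Class \<open>C\<^sup>1\<close> in the following sense: if the derivative at \<open>0\<close> is finite, this is \<open>C\<^sup>1\<close> on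
  \<open>[0, \<infinity>)\<close>; if it is infinite, continuity on \<open>[0, \<infinity>)\<close> and \<open>C\<^sup>1\<close> on \<open>(0, \<infinity>)\<close>. The one-sided
  derivative at \<open>0\<close> is required to exist in \<open>ereal\<close>, so that the limit in \<open>ederiv\<close> is meaningful.
\<close>

definition C1_half_line :: "(real \<Rightarrow> real) \<Rightarrow> bool" where
  "C1_half_line h \<longleftrightarrow>
     continuous_on {0..} h \<and>
     (\<forall>x>0. h differentiable (at x)) \<and>
     continuous_on {0<..} (deriv h) \<and>
     (\<exists>d. ((\<lambda>t. ereal ((h t - h 0) / t)) \<longlongrightarrow> d) (at_right 0)) \<and>
     (\<forall>d::real. ((\<lambda>t. (h t - h 0) / t) \<longlongrightarrow> d) (at_right 0) \<longrightarrow> (deriv h \<longlongrightarrow> d) (at_right 0))"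

definition strictly_convex_on :: "real set \<Rightarrow> (real \<Rightarrow> real) \<Rightarrow> bool" where
  "strictly_convex_on S h \<longleftrightarrow> convex S \<and>
     (\<forall>x\<in>S. \<forall>y\<in>S. \<forall>t. x \<noteq> y \<and> 0 < t \<and> t < 1 \<longrightarrow>
        h ((1 - t) * x + t * y) < (1 - t) * h x + t * h y)"

definition strictly_concave_on :: "real set \<Rightarrow> (real \<Rightarrow> real) \<Rightarrow> bool" where
  "strictly_concave_on S h \<longleftrightarrow> strictly_convex_on S (\<lambda>x. - h x)"

definition at_infty :: "(real \<Rightarrow> real) \<Rightarrow> ereal" where
  "at_infty h = Lim at_top (\<lambda>x. ereal (h x))"

text \<open>
  The inverse of the derivative takes extended arguments: if the derivative at \<open>0\<close> is infinite,
  then \<open>inv_deriv h \<infinity> = 0\<close>.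
\<close>

definition inv_deriv :: "(real \<Rightarrow> real) \<Rightarrow> ereal \<Rightarrow> real" where
  "inv_deriv h = inv_into {0..} (ederiv h)"


section \<open>The model\<close>

text \<open>
  The fields \<open>risk_u\<close>, \<open>risk_v\<close>, \<open>debt\<close>, \<open>rate\<close> are the parameters \<open>u\<close>, \<open>v\<close>, \<open>D\<close>, \<open>r\<^sub>I\<close>;
  \<open>ben_a\<close>, \<open>ben_m\<close>, \<open>ben_e\<close> are \<open>b\<^sup>a\<close>, \<open>b\<^sup>m\<close>, \<open>b\<^sup>e\<close>; \<open>gain\<close> is \<open>g\<close> and \<open>fin_cost\<close> is \<open>f\<close>.
\<close>

record 'w model =
  sample :: "'w measure"
  mu :: "'w \<Rightarrow> real"
  mu_low :: real
  risk_u :: real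
  risk_v :: real
  debt :: real
  rate :: real
  delta :: real
  phi :: "real \<Rightarrow> real"
  psi :: "real \<Rightarrow> real"
  gain :: "real \<Rightarrow> real"
  ben_a :: "real \<Rightarrow> real"
  ben_m :: "real \<Rightarrow> real"
  ben_e :: "real \<Rightarrow> real"
  fin_cost :: "real \<Rightarrow> real"

definition F_of :: "'w model \<Rightarrow> real \<Rightarrow> real" where
  "F_of P a = ben_a P a - fin_cost P ((1 + rate P) * (debt P + a))"

locale outsourcing = prob_space "sample P" for P :: "'w model" +
  assumes risk_pos: "0 < risk_u P" "0 < risk_v P"
    and debt_pos: "0 < debt P"
    and rate_nonneg: "0 \<le> rate P"
    and mu_measurable: "mu P \<in> borel_measurable (sample P)"
    and mu_nonconst: "\<nexists>c. AE \<omega> in sample P. mu P \<omega> = c"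
    and mu_bounded_below: "AE \<omega> in sample P. mu_low P \<le> mu P \<omega>"
    and mu_exp_moments: "\<And>l::real. integrable (sample P) (\<lambda>\<omega>. exp (l * mu P \<omega>))"
    and phi_nonneg: "\<And>x. 0 \<le> x \<Longrightarrow> 0 \<le> phi P x"
    and phi_C1: "C1_half_line (phi P)"
    and phi_mono: "mono_on {0..} (phi P)"
    and phi_concave: "strictly_concave_on {0..} (phi P)"
    and phi_deriv_0: "ederiv (phi P) 0 = \<infinity>"
    and phi_deriv_infty: "(ederiv (phi P) \<longlongrightarrow> 0) at_top"
    and psi_nonneg: "\<And>x. 0 \<le> x \<Longrightarrow> 0 \<le> psi P x"
    and psi_C1: "C1_half_line (psi P)"
    and psi_mono: "mono_on {0..} (psi P)"
    and psi_concave: "strictly_concave_on {0..} (psi P)"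
    and psi_deriv_0: "ederiv (psi P) 0 = \<infinity>"
    and psi_deriv_infty: "(ederiv (psi P) \<longlongrightarrow> 0) at_top"
    and phi_psi_small:
      "at_infty (phi P) + ereal (max (delta P) 0) * at_infty (psi P) < ereal (mu_low P)"
    and inv_deriv_equiv:
      "(\<lambda>x. inv_deriv (phi P) (ereal x)) \<sim>[at_right 0] (\<lambda>x. inv_deriv (psi P) (ereal x))"
    and gain_C1: "C1_half_line (gain P)"
    and gain_mono: "mono_on {0..} (gain P)"
    and gain_concave: "strictly_concave_on {0..} (gain P)"
    and gain_deriv_0: "ederiv (gain P) 0 = \<infinity>"
    and gain_deriv_infty: "(ederiv (gain P) \<longlongrightarrow> 0) at_top"
    and gain_pos: "\<exists>m>0. gain P m > 0"
    and ben_a_nonneg: "\<And>x. 0 \<le> x \<Longrightarrow> 0 \<le> ben_a P x"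
    and ben_a_C1: "C1_half_line (ben_a P)"
    and ben_a_mono: "mono_on {0..} (ben_a P)"
    and ben_a_concave: "concave_on {0..} (ben_a P)"
    and ben_a_deriv_0: "0 < ederiv (ben_a P) 0"
    and ben_a_deriv_infty: "(ederiv (ben_a P) \<longlongrightarrow> 0) at_top"
    and ben_a_bounded: "at_infty (ben_a P) < \<infinity>"
    and ben_m_nonneg: "\<And>x. 0 \<le> x \<Longrightarrow> 0 \<le> ben_m P x"
    and ben_m_C1: "C1_half_line (ben_m P)"
    and ben_m_mono: "mono_on {0..} (ben_m P)"
    and ben_m_concave: "concave_on {0..} (ben_m P)"
    and ben_m_deriv_0: "ederiv (ben_m P) 0 = \<infinity>"
    and ben_m_deriv_infty: "(ederiv (ben_m P) \<longlongrightarrow> 0) at_top"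
    and ben_e_nonneg: "\<And>x. 0 \<le> x \<Longrightarrow> 0 \<le> ben_e P x"
    and ben_e_C1: "C1_half_line (ben_e P)"
    and ben_e_mono: "mono_on {0..} (ben_e P)"
    and ben_e_concave: "concave_on {0..} (ben_e P)"
    and ben_e_deriv_0: "ederiv (ben_e P) 0 = \<infinity>"
    and ben_e_deriv_infty: "(ederiv (ben_e P) \<longlongrightarrow> 0) at_top"
    and fin_cost_differentiable: "fin_cost P differentiable_on {0..}"
    and fin_cost_mono: "mono_on {0..} (fin_cost P)"
    and fin_cost_convex: "strictly_convex_on {0..} (fin_cost P)"
    and fin_cost_deriv_infty: "(ederiv (fin_cost P) \<longlongrightarrow> \<infinity>) at_top"
    and F_deriv_0: "0 < ederiv (F_of P) 0"


section \<open>Payoffs and Nash equilibria\<close>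

definition U_of :: "'w model \<Rightarrow> real \<Rightarrow> real" where
  "U_of P x = - exp (- risk_u P * x)"

definition V_of :: "'w model \<Rightarrow> real \<Rightarrow> real" where
  "V_of P x = - exp (- risk_v P * x)"

definition C_op :: "'w model \<Rightarrow> real \<Rightarrow> real \<Rightarrow> 'w \<Rightarrow> real" where
  "C_op P e a \<omega> = mu P \<omega> - phi P e - delta P * psi P a"

text \<open>Both payoffs take the arguments in the order \<open>\<alpha>, \<beta>, \<gamma>, e, m, a\<close>.\<close>

definition J2 :: "'w model \<Rightarrow> real \<Rightarrow> real \<Rightarrow> real \<Rightarrow> real \<Rightarrow> real \<Rightarrow> real \<Rightarrow> real" where
  "J2 P \<alpha> \<beta> \<gamma> e m a =
     (\<integral>\<omega>. V_of P (\<alpha> + (\<beta> - 1) * C_op P e a \<omega> - e + \<gamma> * gain P m - m) \<partial>sample P)"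

definition I2 :: "'w model \<Rightarrow> real \<Rightarrow> real \<Rightarrow> real \<Rightarrow> real \<Rightarrow> real \<Rightarrow> real \<Rightarrow> real" where
  "I2 P \<alpha> \<beta> \<gamma> e m a =
     (\<integral>\<omega>. F_of P a
        + U_of P (ben_m P m + ben_e P e - \<alpha> - \<beta> * C_op P e a \<omega> - \<gamma> * gain P m) \<partial>sample P)"

definition nash2 :: "'w model \<Rightarrow> real \<times> real \<times> real \<times> real \<times> real \<times> real \<Rightarrow> bool" where
  "nash2 P = (\<lambda>(\<alpha>, \<beta>, \<gamma>, e, m, a).
     is_arg_max (\<lambda>(e', m'). J2 P \<alpha> \<beta> \<gamma> e' m' a) (\<lambda>(e', m'). 0 \<le> e' \<and> 0 \<le> m') (e, m) \<and>
     is_arg_max (\<lambda>(a', \<alpha>', \<beta>', \<gamma>'). I2 P \<alpha>' \<beta>' \<gamma>' e m a')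
       (\<lambda>(a', \<alpha>', \<beta>', \<gamma>'). 0 \<le> a' \<and> 0 \<le> \<alpha>' \<and> 0 \<le> \<gamma>' \<and> V_of P 0 \<le> J2 P \<alpha>' \<beta>' \<gamma>' e m a')
       (a, \<alpha>, \<beta>, \<gamma>))"


section \<open>The explicit solution\<close>

text \<open>Division is in \<open>ereal\<close>, where \<open>1 / 0 = \<infinity>\<close>, \<open>1 / \<infinity> = 0\<close> and \<open>x / \<infinity> = 0\<close> for real \<open>x\<close>.\<close>

definition e_star :: "'w model \<Rightarrow> real \<Rightarrow> real" where
  "e_star P \<beta> = inv_deriv (phi P) (1 / ereal (max (1 - \<beta>) 0))"

definition C_of :: "'w model \<Rightarrow> real \<Rightarrow> real" where
  "C_of P \<beta> = 1 / risk_v P *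
     ln (\<integral>\<omega>. exp (risk_v P * (1 - \<beta>) * (mu P \<omega> - phi P (e_star P \<beta>))) \<partial>sample P)"

definition m_zero :: "'w model \<Rightarrow> real" where
  "m_zero P = Inf {m. 0 < m \<and> 0 < gain P m}"

definition G_of :: "'w model \<Rightarrow> real \<Rightarrow> real" where
  "G_of P m = real_of_ereal (ereal (gain P m) / ederiv (gain P) m) - m"

definition G_inv :: "'w model \<Rightarrow> real \<Rightarrow> real" where
  "G_inv P = inv_into {m_zero P..} (G_of P)"

definition B_of :: "'w model \<Rightarrow> real \<Rightarrow> real" where
  "B_of P m =
     (let u = risk_u P; v = risk_v P; e = e_star P (v / (u + v)) in
      exp (u * (m - ben_m P m)) * exp (u * (e - ben_e P e)) * exp ((u + v) * C_of P (v / (u + v))))"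

definition beta_hat :: "'w model \<Rightarrow> real" where
  "beta_hat P = risk_v P / (risk_u P + risk_v P)"

definition e_hat :: "'w model \<Rightarrow> real" where
  "e_hat P = inv_deriv (phi P) (ereal ((risk_u P + risk_v P) / risk_u P))"

definition gamma_hat :: "'w model \<Rightarrow> real \<Rightarrow> real" where
  "gamma_hat P m = real_of_ereal (1 / ederiv (gain P) m)"

definition alpha_hat :: "'w model \<Rightarrow> real \<Rightarrow> real \<Rightarrow> real" where
  "alpha_hat P m a = C_of P (beta_hat P) + e_hat P
     - risk_u P / (risk_u P + risk_v P) * delta P * psi P a - G_of P m"

definition value_I :: "'w model \<Rightarrow> real \<Rightarrow> real \<Rightarrow> real" where
  "value_I P m a = F_of P a - exp (- risk_u P * delta P * psi P a) * B_of P m"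

definition optimal_a :: "'w model \<Rightarrow> real \<Rightarrow> real \<Rightarrow> bool" where
  "optimal_a P m a \<longleftrightarrow> is_arg_max (value_I P m) (\<lambda>a'. 0 \<le> a') a"

end

theory Submission
  imports Defs
begin

text \<open>
  Firm J's payoff separates into concave problems for \<open>e\<close> and \<open>m\<close>, solved by the first-order
  conditions \<open>\<phi>'(e) = 1 / (1 - \<beta>)\<close> and \<open>\<gamma> = 1 / g'(m)\<close>. Firm I's payoff and the participation constraint
  depend on \<open>\<alpha>\<close> and \<open>\<gamma>\<close> only through the transfer \<open>\<alpha> + \<gamma> g(m)\<close>, so the constraint binds. What remains
  for \<open>\<beta>\<close> is to minimise \<open>u / v * \<Lambda> (v * (1 - \<beta>)) + \<Lambda> (u * \<beta>)\<close>, where \<open>\<Lambda>\<close>, the logarithm of the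
  moment generating function of \<open>\<mu>\<close>, is strictly convex because \<open>\<mu>\<close> is not constant; hence
  \<open>\<beta> = v / (u + v)\<close>, whatever \<open>a\<close> is. Since the operating cost stays below the lower bound of \<open>\<mu>\<close>,
  the binding transfer is positive for every \<open>a\<close> and can be paid by \<open>\<alpha>\<close> alone, so the choice of
  \<open>a\<close> is unconstrained.
\<close>

section \<open>Concave functions on the half-line with Inada conditions\<close>

lemma strictly_convex_onD:
  "strictly_convex_on S h \<Longrightarrow> x \<in> S \<Longrightarrow> y \<in> S \<Longrightarrow> x \<noteq> y \<Longrightarrow> 0 < t \<Longrightarrow> t < 1 \<Longrightarrow>
    h ((1 - t) * x + t * y) < (1 - t) * h x + t * h y"
  by (simp add: strictly_convex_on_def)

lemma strictly_convex_on_imp_convex_on: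
  assumes "strictly_convex_on S h"
  shows "convex_on S h"
proof (rule convex_onI)
  fix t x y :: real
  assume *: "0 < t" "t < 1" "x \<in> S" "y \<in> S"
  show "h ((1 - t) *\<^sub>R x + t *\<^sub>R y) \<le> (1 - t) * h x + t * h y"
  proof (cases "x = y")
    case True
    have "(1 - t) * y + t * y = y" by (simp add: algebra_simps)
    then show ?thesis using True by (simp add: algebra_simps)
  next
    case False
    then show ?thesis using strictly_convex_onD[OF assms, of x y t] * by simp
  qed
qed (use assms in \<open>simp add: strictly_convex_on_def\<close>)

text \<open>\<open>Lim\<close> carries no information unless the limit exists. Monotonicity makes
  the values converge in \<open>ereal\<close> to their supremum, so \<open>at_infty h\<close> is
  that supremum.\<close>

lemma mono_le_at_infty:
  assumes "mono_on {0..} h" "0 \<le> x"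
  shows "ereal (h x) \<le> at_infty h"
proof -
  let ?S = "SUP y\<in>{0..}. ereal (h y)"
  have "((\<lambda>y. ereal (h y)) \<longlongrightarrow> ?S) at_top"
  proof (rule order_tendstoI)
    fix z assume "z < ?S"
    then obtain y where y: "0 \<le> y" "z < ereal (h y)" by (auto simp: less_SUP_iff)
    have "z < ereal (h w)" if "y \<le> w" for w
    proof -
      have "h y \<le> h w" using assms(1) y(1) that by (intro mono_onD[of "{0..}" h]) auto
      with y(2) show ?thesis by (metis ereal_less_eq(3) less_le_trans)
    qed
    then show "\<forall>\<^sub>F w in at_top. z < ereal (h w)" by (auto simp: eventually_at_top_linorder)
  next
    fix z assume "?S < z"
    then have "ereal (h w) < z" if "0 \<le> w" for w
      by (rule le_less_trans[rotated]) (use that in \<open>auto intro: SUP_upper\<close>)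
    then show "\<forall>\<^sub>F w in at_top. ereal (h w) < z" by (auto simp: eventually_at_top_linorder)
  qed
  then have "at_infty h = ?S" unfolding at_infty_def by (intro tendsto_Lim) auto
  then show ?thesis using assms(2) by (auto intro: SUP_upper)
qed

text \<open>The graph of \<open>exp\<close> lies strictly above its tangent at the weighted mean
  \<open>w\<close>, except at \<open>w\<close> itself. Averaging the two tangent bounds cancels the
  linear term.\<close>

lemma exp_weighted_less:
  fixes x y \<theta> :: real
  assumes "x \<noteq> y" "0 < \<theta>" "\<theta> < 1"
  shows "exp (\<theta> * x + (1 - \<theta>) * y) < \<theta> * exp x + (1 - \<theta>) * exp y"
proof -
  define w where "w = \<theta> * x + (1 - \<theta>) * y"
  have tangent: "exp w * (1 + (z - w)) < exp z" if "z \<noteq> w" for z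
  proof -
    have "exp w * (1 + (z - w)) < exp w * exp (z - w)"
      using exp_minus_greater[of "w - z"] that by simp
    then show ?thesis by (simp add: exp_diff)
  qed
  have "x - w = (1 - \<theta>) * (x - y)" "y - w = \<theta> * (y - x)"
    by (simp_all add: w_def algebra_simps)
  with assms have "x \<noteq> w" "y \<noteq> w"
    by (metis diff_gt_0_iff_gt less_irrefl mult_eq_0_iff right_minus_eq)+
  then have "\<theta> * (exp w * (1 + (x - w))) + (1 - \<theta>) * (exp w * (1 + (y - w)))
      < \<theta> * exp x + (1 - \<theta>) * exp y"
    using assms tangent by (intro add_strict_mono mult_strict_left_mono) auto
  moreover have "\<theta> * (exp w * (1 + (x - w))) + (1 - \<theta>) * (exp w * (1 + (y - w)))
      = exp w * (1 + (\<theta> * x + (1 - \<theta>) * y - w))"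
    by (simp add: algebra_simps)
  ultimately show ?thesis by (simp add: w_def)
qed

locale inada =
  fixes h :: "real \<Rightarrow> real"
  assumes C1: "C1_half_line h"
    and mono: "mono_on {0..} h"
    and concave: "strictly_concave_on {0..} h"
    and deriv_0: "ederiv h 0 = \<infinity>"
    and deriv_infty: "(ederiv h \<longlongrightarrow> 0) at_top"
begin

lemma has_deriv: "0 < x \<Longrightarrow> (h has_real_derivative deriv h x) (at x)"
  using C1 by (auto simp: C1_half_line_def DERIV_deriv_iff_real_differentiable)

lemma continuous: "continuous_on {0..} h"
  using C1 by (simp add: C1_half_line_def)

lemma continuous_deriv: "continuous_on {0<..} (deriv h)"
  using C1 by (simp add: C1_half_line_def)

lemma ederiv_eq: "0 < x \<Longrightarrow> ederiv h x = ereal (deriv h x)"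
  by (simp add: ederiv_def)

lemma convex_neg: "convex_on {0..} (\<lambda>x. - h x)"
  using concave by (auto simp: strictly_concave_on_def intro: strictly_convex_on_imp_convex_on)

lemma below_tangent:
  assumes "0 < x" "0 \<le> y"
  shows "h y \<le> h x + deriv h x * (y - x)"
proof -
  have "((\<lambda>x. - h x) has_real_derivative - deriv h x) (at x within {0..})"
    using has_field_derivative_at_within[OF has_deriv[OF assms(1)]] by (rule DERIV_minus)
  then have "- h y - (- h x) \<ge> - deriv h x * (y - x)"
    using assms by (intro convex_on_imp_above_tangent[OF convex_neg])
      (simp_all add: convex_connected convex_real_interval)
  then show ?thesis by (simp add: algebra_simps)
qed

lemma below_tangent_strict:
  assumes "0 < x" "0 \<le> y" "x \<noteq> y"
  shows "h y < h x + deriv h x * (y - x)"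
proof -
  have "(1 - 1/2) * h x + 1/2 * h y < h ((1 - 1/2) * x + 1/2 * y)"
    using strictly_convex_onD[OF concave[unfolded strictly_concave_on_def], of x y "1/2"] assms
    by simp
  also have "\<dots> \<le> h x + deriv h x * ((1 - 1/2) * x + 1/2 * y - x)"
    by (rule below_tangent) (use assms in auto)
  finally show ?thesis by (simp add: field_simps)
qed

lemma deriv_pos: "0 < x \<Longrightarrow> 0 < deriv h x"
  using below_tangent_strict[of x "x + 1"] mono_onD[OF mono, of x "x + 1"] by auto

lemma deriv_strict_antimono:
  assumes "0 < x" "x < y"
  shows "deriv h y < deriv h x"
proof -
  have "h y < h x + deriv h x * (y - x)" "h x < h y + deriv h y * (x - y)"
    using assms by (auto intro!: below_tangent_strict)
  then have "0 < (deriv h x - deriv h y) * (y - x)" by (simp add: algebra_simps)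
  then show ?thesis using assms by (simp add: zero_less_mult_iff)
qed

lemma strict_mono:
  assumes "0 \<le> x" "x < y"
  shows "h x < h y"
proof -
  have "h x < h y + deriv h y * (x - y)" using below_tangent_strict[of y x] assms by simp
  moreover have "deriv h y * (x - y) < 0" using deriv_pos[of y] assms by (simp add: mult_pos_neg)
  ultimately show ?thesis by simp
qed

text \<open>\<open>ederiv\<close> at \<open>0\<close> is a \<open>Lim\<close>, so
  \<open>deriv_0\<close> alone gives no convergence; \<open>C1_half_line\<close> supplies the
  existence of the limit.\<close>

lemma quotient_tendsto: "((\<lambda>t. ereal ((h t - h 0) / t)) \<longlongrightarrow> \<infinity>) (at_right 0)"
proof -
  obtain d where d: "((\<lambda>t. ereal ((h t - h 0) / t)) \<longlongrightarrow> d) (at_right 0)"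
    using C1 by (auto simp: C1_half_line_def)
  with deriv_0 have "d = \<infinity>"
    using tendsto_Lim[OF trivial_limit_at_right_real d] by (simp add: ederiv_def)
  with d show ?thesis by simp
qed

lemma steep_at_0: "\<exists>t>0. K * t < h t - h 0"
proof -
  have "\<forall>\<^sub>F t in at_right 0. ereal K < ereal ((h t - h 0) / t)"
    using quotient_tendsto by (simp add: tendsto_PInfty)
  then obtain b where "0 < b" and b: "\<And>t. 0 < t \<Longrightarrow> t < b \<Longrightarrow> K < (h t - h 0) / t"
    by (auto simp: eventually_at_right_field)
  from \<open>0 < b\<close> b[of "b/2"] have "0 < b/2" "K * (b/2) < h (b/2) - h 0"
    by (auto simp: field_simps)
  then show ?thesis by blast
qed

text \<open>The mean value theorem turns a chord from \<open>0\<close> steeper than \<open>K\<close>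
  into a tangent steeper than \<open>K\<close>; towards \<open>0\<close> the derivative only
  grows.\<close>

lemma deriv_unbounded: "\<exists>s>0. \<forall>t. 0 < t \<and> t \<le> s \<longrightarrow> K < deriv h t"
proof -
  obtain t where "0 < t" and t: "K * t < h t - h 0" using steep_at_0 by blast
  have "continuous_on {0..t} h" by (rule continuous_on_subset[OF continuous]) auto
  then obtain s where s: "0 < s" "s < t" "h t - h 0 = deriv h s * (t - 0)"
    using mvt[OF \<open>0 < t\<close>, of h "\<lambda>x. (*) (deriv h x)"] has_deriv
    by (auto simp: has_field_derivative_def)
  then have "K < deriv h s" using t \<open>0 < t\<close> by simp
  then have "K < deriv h r" if "0 < r" "r \<le> s" for r
    using deriv_strict_antimono[OF \<open>0 < r\<close>, of s] that by (cases "r = s") auto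
  then show ?thesis using s by blast
qed

lemma deriv_small: "0 < K \<Longrightarrow> \<exists>s>0. \<forall>t\<ge>s. deriv h t < K"
proof -
  assume "0 < K"
  then have "\<forall>\<^sub>F x in at_top. ederiv h x < ereal K"
    using order_tendstoD(2)[OF deriv_infty] by simp
  then obtain s where s: "\<And>x. s \<le> x \<Longrightarrow> ederiv h x < ereal K"
    by (auto simp: eventually_at_top_linorder)
  then have "\<forall>t\<ge>max s 1. deriv h t < K"
    by (metis ederiv_eq ereal_less(2) le_max_iff_disj less_ereal.simps(1) max.boundedE
        order_less_le_trans zero_less_one)
  then show ?thesis
    by (meson less_max_iff_disj zero_less_one)
qed

lemma deriv_surj:
  assumes "0 < y"
  shows "\<exists>x>0. deriv h x = y"
proof -
  obtain s where s: "s > 0" "y < deriv h s" using deriv_unbounded[of y] by blast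
  obtain t where t: "t > 0" "\<And>r. r \<ge> t \<Longrightarrow> deriv h r < y" using deriv_small[OF assms] by blast
  have "s < t" using s t(2)[of s] by force
  have "continuous_on {s..t} (deriv h)"
    by (rule continuous_on_subset[OF continuous_deriv]) (use s in auto)
  then have "\<exists>x\<ge>s. x \<le> t \<and> deriv h x = y"
    using IVT2'[of "deriv h" t y s] s t(2)[of t] \<open>s < t\<close> by auto
  then obtain x where "s \<le> x" "deriv h x = y" by blast
  with s(1) show ?thesis by (intro exI[of _ x]) simp
qed

lemma ederiv_neq:
  assumes "0 \<le> x" "x < y"
  shows "ederiv h x \<noteq> ederiv h y"
proof (cases "x = 0")
  case True
  with assms show ?thesis by (simp add: deriv_0 ederiv_eq)
next
  case False
  with assms have "deriv h y < deriv h x" by (intro deriv_strict_antimono) auto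
  with False assms show ?thesis by (simp add: ederiv_eq)
qed

lemma inj_ederiv: "inj_on (ederiv h) {0..}"
proof (rule inj_onI)
  fix x y :: real
  assume *: "x \<in> {0..}" "y \<in> {0..}" "ederiv h x = ederiv h y"
  show "x = y"
  proof (rule ccontr)
    assume "x \<noteq> y"
    then have "x < y \<or> y < x" by (rule linorder_neqE_linordered_idom) simp_all
    then show False using * ederiv_neq[of x y] ederiv_neq[of y x] by (elim disjE) simp_all
  qed
qed

lemma inv_deriv_eqI: "0 \<le> x \<Longrightarrow> ederiv h x = y \<Longrightarrow> inv_deriv h y = x"
  using inv_into_f_f[OF inj_ederiv, of x] by (simp add: inv_deriv_def)

lemma inv_deriv:
  assumes "0 < y"
  shows "0 < inv_deriv h (ereal y)" "deriv h (inv_deriv h (ereal y)) = y"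
proof -
  obtain x where "x > 0" "deriv h x = y" using deriv_surj[OF assms] by blast
  then have "inv_deriv h (ereal y) = x" by (intro inv_deriv_eqI) (auto simp: ederiv_eq)
  with \<open>x > 0\<close> \<open>deriv h x = y\<close> show "0 < inv_deriv h (ereal y)" "deriv h (inv_deriv h (ereal y)) = y"
    by auto
qed

text \<open>The reciprocal \<open>1 / h'(x)\<close>, equal to \<open>0\<close> at
  \<open>x = 0\<close> because the slope there is infinite. It is the multiplier \<open>c\<close>
  for which \<open>x\<close> maximises \<open>c * h y - y\<close>; for \<open>gain P\<close> it is
  \<open>gamma_hat P\<close>.\<close>

definition slope_inv :: "real \<Rightarrow> real" where
  "slope_inv x = real_of_ereal (1 / ederiv h x)"

lemma slope_inv_0 [simp]: "slope_inv 0 = 0"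
  by (simp add: slope_inv_def deriv_0)

lemma slope_inv_pos_eq:
  assumes "0 < x"
  shows "slope_inv x = 1 / deriv h x"
proof -
  have "1 / ederiv h x = ereal 1 / ereal (deriv h x)"
    using assms by (simp only: ederiv_eq one_ereal_def)
  also have "\<dots> = ereal (1 / deriv h x)"
    using deriv_pos[OF assms] by (subst ereal_divide) simp
  finally show ?thesis by (simp add: slope_inv_def)
qed

lemma slope_inv_pos: "0 < x \<Longrightarrow> 0 < slope_inv x"
  using deriv_pos by (simp add: slope_inv_pos_eq)

lemma slope_inv_nonneg: "0 \<le> x \<Longrightarrow> 0 \<le> slope_inv x"
  using slope_inv_pos[of x] by (cases "x = 0") auto

lemma slope_inv_strict_mono:
  assumes "0 \<le> x" "x < y"
  shows "slope_inv x < slope_inv y"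
proof (cases "x = 0")
  case False
  with assms have "deriv h y < deriv h x" "0 < deriv h y"
    by (auto intro: deriv_strict_antimono deriv_pos)
  then have "1 / deriv h x < 1 / deriv h y" by (intro divide_strict_left_mono) auto
  with False assms show ?thesis by (simp add: slope_inv_pos_eq)
qed (use assms slope_inv_pos in simp)

text \<open>Scaled by \<open>slope_inv x\<close>, the tangent at a positive \<open>x\<close> has
  slope one and so cancels the cost \<open>y\<close>. At \<open>x = 0\<close> the multiplier
  vanishes and only the cost remains.\<close>

lemma maximizer_unique:
  assumes "0 \<le> x" "0 \<le> y" "x \<noteq> y"
  shows "slope_inv x * h y - y < slope_inv x * h x - x"
proof (cases "x = 0")
  case True
  with assms show ?thesis by simp
next
  case False
  with assms have x: "0 < x" by simp
  have "slope_inv x * h y < slope_inv x * (h x + deriv h x * (y - x))"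
    using below_tangent_strict[OF x assms(2,3)] slope_inv_pos[OF x] by (rule mult_strict_left_mono)
  also have "\<dots> = slope_inv x * h x + (y - x)"
    using x deriv_pos[OF x] by (simp add: slope_inv_pos_eq field_simps)
  finally show ?thesis by simp
qed

text \<open>For the converse with \<open>c > 0\<close>, some \<open>z\<close> has slope
  \<open>1 / c\<close>, and uniqueness of its maximum forces \<open>x = z\<close>. This avoids a
  first-order condition at the corner \<open>0\<close>.\<close>

lemma maximizer_iff:
  assumes "0 \<le> x" "0 \<le> c"
  shows "(\<forall>y\<ge>0. c * h y - y \<le> c * h x - x) \<longleftrightarrow> c = slope_inv x"
proof
  assume "c = slope_inv x"
  then show "\<forall>y\<ge>0. c * h y - y \<le> c * h x - x"
    using maximizer_unique assms by (metis order_le_less)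
next
  assume *: "\<forall>y\<ge>0. c * h y - y \<le> c * h x - x"
  show "c = slope_inv x"
  proof (cases "c = 0")
    case True
    with * have "- 0 \<le> - x" by force
    with assms True show ?thesis by simp
  next
    case False
    with assms have "0 < 1 / c" by simp
    then obtain z where z: "z > 0" "deriv h z = 1 / c" using deriv_surj by blast
    then have c: "c = slope_inv z" by (simp add: slope_inv_pos_eq)
    from * z have "c * h z - z \<le> c * h x - x" by simp
    with maximizer_unique[of z x] z c assms have "z = x" by (cases "z = x") auto
    with c show ?thesis by simp
  qed
qed

lemma continuous_slope_inv: "continuous_on {0..} slope_inv"
  unfolding continuous_on_eq_continuous_within
proof
  fix x :: real
  assume "x \<in> {0..}"
  show "continuous (at x within {0..}) slope_inv"
  proof (cases "x = 0")
    case True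
    have "\<exists>d>0. \<forall>y\<in>{0..}. dist y 0 < d \<longrightarrow> dist (slope_inv y) (slope_inv 0) < e" if "0 < e" for e
    proof -
      obtain s where s: "s > 0" "\<And>t. 0 < t \<Longrightarrow> t \<le> s \<Longrightarrow> 1 / e < deriv h t"
        using deriv_unbounded[of "1 / e"] by blast
      have "slope_inv y < e" if "0 \<le> y" "y < s" for y
      proof (cases "y = 0")
        case False
        with that s(2)[of y] \<open>0 < e\<close> deriv_pos[of y] show ?thesis
          by (simp add: slope_inv_pos_eq field_simps)
      qed (use \<open>0 < e\<close> in simp)
      then show ?thesis
        using s(1) by (intro exI[of _ s]) (auto simp: dist_real_def slope_inv_nonneg)
    qed
    with True show ?thesis by (simp add: continuous_within_eps_delta)
  next
    case False
    with \<open>x \<in> {0..}\<close> have "0 < x" by simp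
    have "continuous_on {0<..} (\<lambda>x. 1 / deriv h x)"
      by (intro continuous_intros continuous_deriv) (use deriv_pos in force)
    then have "continuous_on {0<..} slope_inv"
      by (rule continuous_on_eq) (simp add: slope_inv_pos_eq)
    with \<open>0 < x\<close> have "isCont slope_inv x"
      by (simp add: continuous_on_eq_continuous_at)
    then show ?thesis by (rule continuous_at_imp_continuous_at_within)
  qed
qed

lemma slope_inv_large: "\<exists>s>0. \<forall>t\<ge>s. K < slope_inv t"
proof -
  obtain s where s: "s > 0" "\<And>t. s \<le> t \<Longrightarrow> deriv h t < 1 / max K 1"
    using deriv_small[of "1 / max K 1"] by (auto simp: less_max_iff_disj)
  have "max K 1 < slope_inv t" if "s \<le> t" for t
  proof -
    have "0 < t" using s(1) that by simp
    then have "deriv h t * max K 1 < 1"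
      using s(2)[OF that] by (simp add: less_divide_eq less_max_iff_disj split: if_splits)
    with \<open>0 < t\<close> deriv_pos[of t] show ?thesis
      by (simp add: slope_inv_pos_eq less_divide_eq mult.commute)
  qed
  then have "K < slope_inv t" if "s \<le> t" for t using that by (auto simp: max_less_iff_conj)
  with s(1) show ?thesis by blast
qed

end

section \<open>Payoffs in terms of the moment generating function\<close>

sublocale outsourcing \<subseteq> phi: inada "phi P"
  by unfold_locales (rule phi_C1 phi_mono phi_concave phi_deriv_0 phi_deriv_infty)+

sublocale outsourcing \<subseteq> psi: inada "psi P"
  by unfold_locales (rule psi_C1 psi_mono psi_concave psi_deriv_0 psi_deriv_infty)+

sublocale outsourcing \<subseteq> gain: inada "gain P"
  by unfold_locales (rule gain_C1 gain_mono gain_concave gain_deriv_0 gain_deriv_infty)+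

context outsourcing
begin

abbreviation "u \<equiv> risk_u P"
abbreviation "v \<equiv> risk_v P"
abbreviation "M \<equiv> sample P"

section \<open>The moment generating function of \<open>mu P\<close> and its strict
  log-convexity\<close>

definition mgf :: "real \<Rightarrow> real" where
  "mgf l = (\<integral>\<omega>. exp (l * mu P \<omega>) \<partial>M)"

lemma mgf_pos: "0 < mgf l"
proof -
  have "mgf l \<noteq> 0"
  proof
    assume "mgf l = 0"
    then have "AE \<omega> in M. exp (l * mu P \<omega>) = 0"
      unfolding mgf_def by (subst (asm) integral_nonneg_eq_0_iff_AE) (auto intro: mu_exp_moments)
    then show False by simp
  qed
  moreover have "0 \<le> mgf l" unfolding mgf_def by (intro integral_nonneg_AE) simp
  ultimately show ?thesis by simp
qed

lemma integral_exp_affine: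
  "(\<integral>\<omega>. exp (l * mu P \<omega> + c) \<partial>M) = mgf l * exp c"
  by (simp add: mgf_def exp_add)

lemma integrable_exp_affine: "integrable M (\<lambda>\<omega>. exp (l * mu P \<omega> + c))"
  by (simp add: exp_add mu_exp_moments)

text \<open>The pointwise convexity defect of \<open>exp\<close> integrates to zero only if it vanishes almost
  everywhere, which would make \<open>mu P\<close> constant.\<close>

lemma ln_mgf_strict_convex:
  assumes "p \<noteq> q" "0 < \<theta>" "\<theta> < 1"
  shows "ln (mgf (\<theta> * p + (1 - \<theta>) * q)) < \<theta> * ln (mgf p) + (1 - \<theta>) * ln (mgf q)"
proof (rule ccontr)
  \<comment> \<open>The shifts normalise \<open>exp (p * mu P \<omega> + a)\<close> and
    \<open>exp (q * mu P \<omega> + b)\<close> to expectation one, so failure of the claim makes the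
    mean of the defect \<open>D\<close> at most zero.\<close>
  define a where "a = - ln (mgf p)"
  define b where "b = - ln (mgf q)"
  define r where "r = \<theta> * p + (1 - \<theta>) * q"
  define c where "c = \<theta> * a + (1 - \<theta>) * b"
  define D where "D \<omega> = \<theta> * exp (p * mu P \<omega> + a) + (1 - \<theta>) * exp (q * mu P \<omega> + b)
    - exp (r * mu P \<omega> + c)" for \<omega>
  assume "\<not> ?thesis"
  then have "- c \<le> ln (mgf r)" by (simp add: c_def a_def b_def r_def)
  then have "1 \<le> mgf r * exp c"
    using mgf_pos[of r] by (simp add: ln_ge_iff exp_minus field_simps)
  have eq: "r * x + c = \<theta> * (p * x + a) + (1 - \<theta>) * (q * x + b)" for x
    by (simp add: r_def c_def algebra_simps)
  have less: "exp (r * x + c) < \<theta> * exp (p * x + a) + (1 - \<theta>) * exp (q * x + b)"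
    if "p * x + a \<noteq> q * x + b" for x
    unfolding eq using that assms(2,3) by (rule exp_weighted_less)
  have nonneg: "0 \<le> D \<omega>" for \<omega>
  proof (cases "p * mu P \<omega> + a = q * mu P \<omega> + b")
    case True
    have "\<theta> * y + (1 - \<theta>) * y = y" for y :: real by (simp add: algebra_simps)
    then show ?thesis unfolding D_def eq True by simp
  next
    case False
    then show ?thesis using less[OF False] by (simp add: D_def)
  qed
  have int: "integrable M D"
    unfolding D_def
    by (intro Bochner_Integration.integrable_diff Bochner_Integration.integrable_add
        integrable_mult_right integrable_exp_affine)
  have "(\<integral>\<omega>. D \<omega> \<partial>M) = \<theta> * (mgf p * exp a) + (1 - \<theta>) * (mgf q * exp b) - mgf r * exp c"
    unfolding D_def by (simp add: integrable_exp_affine integral_exp_affine)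
  also have "\<dots> = 1 - mgf r * exp c"
    using mgf_pos[of p] mgf_pos[of q] by (simp add: a_def b_def exp_minus)
  also have "\<dots> \<le> 0" using \<open>1 \<le> mgf r * exp c\<close> by simp
  finally have "(\<integral>\<omega>. D \<omega> \<partial>M) = 0" using nonneg by (simp add: order_antisym integral_nonneg_AE)
  then have "AE \<omega> in M. D \<omega> = 0"
    using integral_nonneg_eq_0_iff_AE[OF int] nonneg by simp
  then have "AE \<omega> in M. mu P \<omega> = (b - a) / (p - q)"
  proof eventually_elim
    case (elim \<omega>)
    then have "p * mu P \<omega> + a = q * mu P \<omega> + b" using less[of "mu P \<omega>"] by (force simp: D_def)
    then show ?case using assms(1) by (simp add: field_simps)
  qed
  with mu_nonconst show False by blast
qed

lemma mgf_gt_exp: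
  assumes "0 < k" "d < mu_low P"
  shows "exp (k * d) < mgf k"
proof -
  have "exp (k * d) < exp (k * mu_low P)" using assms by simp
  also have "\<dots> \<le> mgf k"
    unfolding mgf_def
  proof (rule integral_ge_const[OF mu_exp_moments])
    show "AE \<omega> in M. exp (k * mu_low P) \<le> exp (k * mu P \<omega>)"
      using mu_bounded_below by eventually_elim (use assms in simp)
  qed
  finally show ?thesis .
qed

section \<open>Operating cost and payoffs in closed form\<close>

definition op_cost :: "real \<Rightarrow> real \<Rightarrow> real" where
  "op_cost e a = phi P e + delta P * psi P a"

lemma op_cost_less:
  assumes "0 \<le> e" "0 \<le> a"
  shows "op_cost e a < mu_low P"
proof -
  define d where "d = max (delta P) 0"
  \<comment> \<open>The bound at infinity involves \<open>max (delta P) 0\<close>; replacing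
    \<open>delta P\<close> by it cannot lower the cost because \<open>psi P\<close> is
    nonnegative.\<close>
  have "delta P * psi P a \<le> d * psi P a"
    using psi_nonneg[OF assms(2)] by (intro mult_right_mono) (auto simp: d_def)
  then have "ereal (op_cost e a) \<le> ereal (phi P e) + ereal d * ereal (psi P a)"
    by (simp add: op_cost_def)
  also have "\<dots> \<le> at_infty (phi P) + ereal d * at_infty (psi P)"
    using assms by (intro add_mono ereal_mult_left_mono mono_le_at_infty phi_mono psi_mono)
      (simp_all add: d_def del: ereal_max)
  also have "\<dots> < ereal (mu_low P)" unfolding d_def by (rule phi_psi_small)
  finally show ?thesis by simp
qed

text \<open>Exponential utility of an affine function of \<open>mu P\<close> produces a value of
  \<open>mgf\<close>. Moving it into the exponent as a logarithm lets payoffs be compared through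
  exponents alone.\<close>

lemma J2_eq:
  "J2 P \<alpha> \<beta> \<gamma> e m a =
    - exp (- v * (\<alpha> + (1 - \<beta>) * op_cost e a - e + \<gamma> * gain P m - m) + ln (mgf (v * (1 - \<beta>))))"
proof -
  have "J2 P \<alpha> \<beta> \<gamma> e m a = (\<integral>\<omega>. - exp (v * (1 - \<beta>) * mu P \<omega>
      + (- v * (\<alpha> + (1 - \<beta>) * op_cost e a - e + \<gamma> * gain P m - m))) \<partial>M)"
    unfolding J2_def V_of_def C_op_def op_cost_def
    by (intro Bochner_Integration.integral_cong) (auto simp: algebra_simps)
  then show ?thesis
    using mgf_pos
    by (simp only: integral_minus integral_exp_affine) (simp only: exp_add exp_ln mult.commute)
qed

lemma I2_eq:
  "I2 P \<alpha> \<beta> \<gamma> e m a = F_of P a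
    - exp (u * (\<alpha> + \<gamma> * gain P m - \<beta> * op_cost e a - ben_m P m - ben_e P e) + ln (mgf (u * \<beta>)))"
proof -
  have "I2 P \<alpha> \<beta> \<gamma> e m a = (\<integral>\<omega>. F_of P a - exp (u * \<beta> * mu P \<omega>
      + u * (\<alpha> + \<gamma> * gain P m - \<beta> * op_cost e a - ben_m P m - ben_e P e)) \<partial>M)"
    unfolding I2_def U_of_def C_op_def op_cost_def
    by (intro Bochner_Integration.integral_cong) (auto simp: algebra_simps)
  also have "\<dots> = F_of P a - mgf (u * \<beta>)
      * exp (u * (\<alpha> + \<gamma> * gain P m - \<beta> * op_cost e a - ben_m P m - ben_e P e))"
    by (subst Bochner_Integration.integral_diff)
       (simp_all add: integrable_exp_affine integral_exp_affine prob_space)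
  finally show ?thesis
    using mgf_pos by (simp add: exp_add)
qed

section \<open>Optimal risk sharing and the binding transfer\<close>

lemma one_minus_beta_hat: "1 - beta_hat P = u / (u + v)"
  using risk_pos by (simp add: beta_hat_def field_simps)

text \<open>The common value of the exponents \<open>v * (1 - \<beta>)\<close> and
  \<open>u * \<beta>\<close> at \<open>\<beta> = beta_hat P\<close>; half the harmonic mean of
  \<open>u\<close> and \<open>v\<close>.\<close>

definition k_hat :: real where
  "k_hat = u * v / (u + v)"

lemma k_hat_pos: "0 < k_hat"
  using risk_pos by (simp add: k_hat_def)

lemma k_hat_eq: "v * (1 - beta_hat P) = k_hat" "u * beta_hat P = k_hat"
  unfolding one_minus_beta_hat by (simp_all add: beta_hat_def k_hat_def mult.commute)

lemma beta_hat_eq_iff: "v * (1 - \<beta>) = u * \<beta> \<longleftrightarrow> \<beta> = beta_hat P"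
  using risk_pos by (auto simp: beta_hat_def field_simps)

lemma V_of_0_le_J2_iff:
  "V_of P 0 \<le> J2 P \<alpha> \<beta> \<gamma> e m a \<longleftrightarrow>
    e + m - (1 - \<beta>) * op_cost e a + ln (mgf (v * (1 - \<beta>))) / v \<le> \<alpha> + \<gamma> * gain P m"
  using risk_pos by (simp add: V_of_def J2_eq field_simps)

text \<open>Both exponential certainty equivalents are convex in \<open>\<beta>\<close>; their weighted sum is minimal
  where the two exponents \<open>v (1 - \<beta>)\<close> and \<open>u \<beta>\<close> agree.\<close>

lemma risk_sharing:
  "(u + v) / v * ln (mgf k_hat) \<le> u / v * ln (mgf (v * (1 - \<beta>))) + ln (mgf (u * \<beta>))"
  "\<beta> \<noteq> beta_hat P \<Longrightarrow>
    (u + v) / v * ln (mgf k_hat) < u / v * ln (mgf (v * (1 - \<beta>))) + ln (mgf (u * \<beta>))"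
proof -
  \<comment> \<open>With this weight the convex combination of \<open>v * (1 - \<beta>)\<close> and
    \<open>u * \<beta>\<close> is \<open>k_hat\<close> for every \<open>\<beta>\<close>, and the
    factor \<open>(u + v) / v\<close> turns the weights into \<open>u / v\<close> and
    \<open>1\<close>.\<close>
  define \<theta> where "\<theta> = u / (u + v)"
  have \<theta>: "0 < \<theta>" "\<theta> < 1" "(u + v) / v * \<theta> = u / v" "(u + v) / v * (1 - \<theta>) = 1"
  proof -
    have "1 - \<theta> = v / (u + v)" using risk_pos by (simp add: \<theta>_def field_simps)
    then show "0 < \<theta>" "\<theta> < 1" "(u + v) / v * \<theta> = u / v" "(u + v) / v * (1 - \<theta>) = 1"
      using risk_pos by (simp_all add: \<theta>_def)
  qed
  have k: "\<theta> * (v * (1 - \<beta>)) + (1 - \<theta>) * (u * \<beta>) = k_hat"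
  proof -
    have "1 - \<theta> = v / (u + v)" using risk_pos by (simp add: \<theta>_def field_simps)
    then have "\<theta> * (v * (1 - \<beta>)) + (1 - \<theta>) * (u * \<beta>) = (u * (v * (1 - \<beta>)) + v * (u * \<beta>)) / (u + v)"
      by (simp add: \<theta>_def add_divide_distrib)
    also have "u * (v * (1 - \<beta>)) + v * (u * \<beta>) = u * v" by (simp add: algebra_simps)
    finally show ?thesis by (simp add: k_hat_def)
  qed
  show less: "(u + v) / v * ln (mgf k_hat) < u / v * ln (mgf (v * (1 - \<beta>))) + ln (mgf (u * \<beta>))"
    if "\<beta> \<noteq> beta_hat P"
  proof -
    have "ln (mgf k_hat) < \<theta> * ln (mgf (v * (1 - \<beta>))) + (1 - \<theta>) * ln (mgf (u * \<beta>))"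
      using ln_mgf_strict_convex[of "v * (1 - \<beta>)" "u * \<beta>" \<theta>] \<theta> that k beta_hat_eq_iff by simp
    then have "(u + v) / v * ln (mgf k_hat)
        < (u + v) / v * (\<theta> * ln (mgf (v * (1 - \<beta>))) + (1 - \<theta>) * ln (mgf (u * \<beta>)))"
      using risk_pos by (intro mult_strict_left_mono) auto
    also have "\<dots> = ((u + v) / v * \<theta>) * ln (mgf (v * (1 - \<beta>)))
        + ((u + v) / v * (1 - \<theta>)) * ln (mgf (u * \<beta>))"
      by (simp only: distrib_left mult.assoc)
    finally show ?thesis by (simp only: \<theta> mult_1)
  qed
  show "(u + v) / v * ln (mgf k_hat) \<le> u / v * ln (mgf (v * (1 - \<beta>))) + ln (mgf (u * \<beta>))"
  proof (cases "\<beta> = beta_hat P")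
    case True
    have "(u + v) / v = u / v + 1" using risk_pos by (simp add: field_simps)
    then show ?thesis unfolding True k_hat_eq by (simp add: algebra_simps)
  next
    case False
    then show ?thesis using less by simp
  qed
qed

text \<open>The least transfer \<open>\<alpha> + \<gamma> g(m)\<close> that firm J accepts when \<open>\<beta>\<close> is the optimal risk share,
  and the resulting payoff of firm I.\<close>

definition transfer :: "real \<Rightarrow> real \<Rightarrow> real \<Rightarrow> real" where
  "transfer e m a = e + m - u / (u + v) * op_cost e a + ln (mgf k_hat) / v"

definition best_I :: "real \<Rightarrow> real \<Rightarrow> real \<Rightarrow> real" where
  "best_I e m a = F_of P a
     - exp (u * (e + m - op_cost e a - ben_m P m - ben_e P e) + (u + v) / v * ln (mgf k_hat))"

text \<open>Since the operating cost stays below \<open>mu_low P\<close>, the risk term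
  \<open>ln (mgf k_hat) / v\<close> outweighs firm J's share of that cost. The surplus lets \<alpha>
  carry the transfer alone and later bounds \<open>alpha_hat\<close> from below.\<close>

lemma transfer_gt:
  assumes "0 \<le> e" "0 \<le> a"
  shows "e + m < transfer e m a"
proof -
  have "ln (exp (k_hat * op_cost e a)) < ln (mgf k_hat)"
    using mgf_gt_exp[OF k_hat_pos op_cost_less[OF assms]] mgf_pos
    by (subst ln_less_cancel_iff) auto
  then have "k_hat * op_cost e a / v < ln (mgf k_hat) / v"
    using risk_pos by (simp add: divide_strict_right_mono)
  moreover have "k_hat * op_cost e a / v = u / (u + v) * op_cost e a"
    using risk_pos by (simp add: k_hat_def)
  ultimately show ?thesis by (simp add: transfer_def)
qed

lemma transfer_pos: "0 \<le> e \<Longrightarrow> 0 \<le> m \<Longrightarrow> 0 \<le> a \<Longrightarrow> 0 < transfer e m a"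
  using transfer_gt[of e a m] by simp

lemma I2_at_transfer:
  assumes "\<alpha> + \<gamma> * gain P m = transfer e m a"
  shows "I2 P \<alpha> (beta_hat P) \<gamma> e m a = best_I e m a"
    and "J2 P \<alpha> (beta_hat P) \<gamma> e m a = V_of P 0"
proof -
  have "u * (transfer e m a - beta_hat P * op_cost e a - ben_m P m - ben_e P e) + ln (mgf k_hat)
      = u * (e + m - op_cost e a - ben_m P m - ben_e P e) + (u + v) / v * ln (mgf k_hat)"
  proof -
    have "beta_hat P = 1 - u / (u + v)" using one_minus_beta_hat by simp
    moreover have "(u + v) / v = u / v + 1" using risk_pos by (simp add: field_simps)
    ultimately show ?thesis by (simp only: transfer_def) (simp add: algebra_simps)
  qed
  then show "I2 P \<alpha> (beta_hat P) \<gamma> e m a = best_I e m a"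
    by (simp add: I2_eq best_I_def k_hat_eq assms)
  have "- v * (transfer e m a + u / (u + v) * op_cost e a - e - m) + ln (mgf k_hat) = 0"
    using risk_pos by (simp add: transfer_def)
  moreover have "\<alpha> + (1 - beta_hat P) * op_cost e a - e + \<gamma> * gain P m - m
      = transfer e m a + u / (u + v) * op_cost e a - e - m"
    by (simp add: one_minus_beta_hat flip: assms)
  ultimately show "J2 P \<alpha> (beta_hat P) \<gamma> e m a = V_of P 0"
    by (simp add: J2_eq V_of_def k_hat_eq)
qed

text \<open>Two losses separate firm I from \<open>best_I\<close>: paying more than the least
  acceptable transfer, and a risk share other than \<open>beta_hat P\<close>. Equality forces both
  to vanish, which pins down \<beta> and the total transfer.\<close>

lemma I2_le_best_I:
  assumes "V_of P 0 \<le> J2 P \<alpha> \<beta> \<gamma> e m a"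
  shows "I2 P \<alpha> \<beta> \<gamma> e m a \<le> best_I e m a"
    and "I2 P \<alpha> \<beta> \<gamma> e m a = best_I e m a \<Longrightarrow>
      \<beta> = beta_hat P \<and> \<alpha> + \<gamma> * gain P m = transfer e m a"
proof -
  define s where "s = \<alpha> + \<gamma> * gain P m"
  define s0 where "s0 = e + m - (1 - \<beta>) * op_cost e a + ln (mgf (v * (1 - \<beta>))) / v"
  define c where "c = u * (- \<beta> * op_cost e a - ben_m P m - ben_e P e) + ln (mgf (u * \<beta>))"
  define x where "x = u * (e + m - op_cost e a - ben_m P m - ben_e P e)
    + (u + v) / v * ln (mgf k_hat)"
  have s: "s0 \<le> s" using assms by (simp add: V_of_0_le_J2_iff s_def s0_def)
  have I: "I2 P \<alpha> \<beta> \<gamma> e m a = F_of P a - exp (u * s + c)"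
    by (simp add: I2_eq s_def c_def algebra_simps)
  have best: "best_I e m a = F_of P a - exp x" by (simp only: best_I_def x_def)
  have c: "u * s0 + c = x - (u + v) / v * ln (mgf k_hat)
      + (u / v * ln (mgf (v * (1 - \<beta>))) + ln (mgf (u * \<beta>)))"
    by (simp add: s0_def c_def x_def algebra_simps)
  have x: "x \<le> u * s0 + c" using risk_sharing(1)[of \<beta>] by (simp add: c)
  have us: "u * s0 \<le> u * s" using s risk_pos by simp
  show "I2 P \<alpha> \<beta> \<gamma> e m a \<le> best_I e m a"
    using x us by (simp add: I best)
  assume "I2 P \<alpha> \<beta> \<gamma> e m a = best_I e m a"
  then have "u * s + c = x" by (simp add: I best)
  with x us have eq: "u * s0 + c = x" "u * s = u * s0" by linarith+
  have \<beta>: "\<beta> = beta_hat P" using risk_sharing(2)[of \<beta>] eq(1) by (auto simp: c)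
  moreover from eq(2) have "s = s0" using risk_pos by simp
  moreover have "s0 = transfer e m a"
    unfolding s0_def transfer_def \<beta> k_hat_eq unfolding one_minus_beta_hat ..
  ultimately show "\<beta> = beta_hat P \<and> \<alpha> + \<gamma> * gain P m = transfer e m a"
    by (simp add: s_def)
qed

section \<open>Equilibria\<close>

lemma e_hat_pos: "0 < e_hat P"
  using risk_pos by (simp add: e_hat_def phi.inv_deriv)

lemma slope_inv_e_hat: "phi.slope_inv (e_hat P) = 1 - beta_hat P"
  using risk_pos e_hat_pos
  by (simp add: phi.slope_inv_pos_eq one_minus_beta_hat) (simp add: e_hat_def phi.inv_deriv)

lemma e_star_beta_hat: "e_star P (beta_hat P) = e_hat P"
proof -
  have "max (u / (u + v)) 0 = u / (u + v)" using risk_pos by (intro max_absorb1) simp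
  then have "1 / ereal (max (u / (u + v)) 0) = ereal 1 / ereal (u / (u + v))"
    by (simp only: one_ereal_def)
  also have "\<dots> = ereal ((u + v) / u)"
    using risk_pos by (subst ereal_divide) simp
  finally show ?thesis by (simp only: e_star_def e_hat_def one_minus_beta_hat)
qed

lemma gamma_hat_eq: "gamma_hat P m = gain.slope_inv m"
  by (simp add: gamma_hat_def gain.slope_inv_def)

lemma C_of_beta_hat:
  "C_of P (beta_hat P) = ln (mgf k_hat) / v - u / (u + v) * phi P (e_hat P)"
proof -
  have "(\<integral>\<omega>. exp (v * (1 - beta_hat P) * (mu P \<omega> - phi P (e_hat P))) \<partial>M)
      = (\<integral>\<omega>. exp (k_hat * mu P \<omega> + - k_hat * phi P (e_hat P)) \<partial>M)"
    unfolding k_hat_eq by (simp add: algebra_simps)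
  also have "\<dots> = mgf k_hat * exp (- k_hat * phi P (e_hat P))" by (rule integral_exp_affine)
  finally have "C_of P (beta_hat P) = 1 / v * (ln (mgf k_hat) - k_hat * phi P (e_hat P))"
    using mgf_pos[of k_hat] by (simp add: C_of_def e_star_beta_hat ln_mult)
  then show ?thesis using risk_pos by (simp add: k_hat_def right_diff_distrib)
qed

text \<open>\<open>B_of P m\<close> collects the exponential factors that do not contain
  \<open>a\<close>. The identity turns \<open>optimal_a\<close> into the maximisation of
  \<open>best_I\<close> at \<open>e_hat P\<close>.\<close>

lemma value_I_eq: "value_I P m a = best_I (e_hat P) m a"
proof -
  define L where "L = ln (mgf k_hat)"
  have "(u + v) * C_of P (beta_hat P) = (u + v) / v * L - u * phi P (e_hat P)"
    using risk_pos by (simp add: C_of_beta_hat L_def right_diff_distrib)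
  then have "exp (- u * delta P * psi P a) * B_of P m =
      exp (- u * delta P * psi P a + (u * (m - ben_m P m) + u * (e_hat P - ben_e P (e_hat P))
        + ((u + v) / v * L - u * phi P (e_hat P))))"
    using e_star_beta_hat unfolding beta_hat_def
    by (simp only: B_of_def Let_def exp_add)
  also have "\<dots> = exp (u * (e_hat P + m - op_cost (e_hat P) a - ben_m P m - ben_e P (e_hat P))
      + (u + v) / v * L)"
    by (rule arg_cong[where f = exp]) (simp add: op_cost_def algebra_simps)
  finally show ?thesis by (simp only: value_I_def best_I_def L_def)
qed

lemma G_of_eq:
  assumes "0 \<le> m"
  shows "G_of P m = gain.slope_inv m * gain P m - m"
proof (cases "m = 0")
  case True
  then show ?thesis by (simp add: G_of_def gain_deriv_0)
next
  case False
  with assms gain.deriv_pos[of m] show ?thesis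
    by (simp add: G_of_def gain.ederiv_eq gain.slope_inv_pos_eq)
qed

lemma alpha_hat_eq: "alpha_hat P m a + G_of P m = transfer (e_hat P) m a - m"
  by (simp add: alpha_hat_def C_of_beta_hat transfer_def op_cost_def algebra_simps)

lemma alpha_hat_transfer:
  assumes "0 \<le> m"
  shows "alpha_hat P m a = transfer (e_hat P) m a - gamma_hat P m * gain P m"
  using alpha_hat_eq[of m a] G_of_eq[OF assms] by (simp add: gamma_hat_eq)

section \<open>Best responses and their combination\<close>

lemma best_response_J:
  assumes "0 \<le> \<gamma>" "0 \<le> e" "0 \<le> m"
  shows "is_arg_max (\<lambda>(e', m'). J2 P \<alpha> (beta_hat P) \<gamma> e' m' a) (\<lambda>(e', m'). 0 \<le> e' \<and> 0 \<le> m') (e, m)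
    \<longleftrightarrow> e = e_hat P \<and> \<gamma> = gamma_hat P m"
    (is "?lhs \<longleftrightarrow> _")
proof -
  define c where "c = 1 - beta_hat P"
  have "0 \<le> c" using risk_pos by (simp add: c_def one_minus_beta_hat)
  have "J2 P \<alpha> (beta_hat P) \<gamma> e' m' a = - exp (- v * (\<alpha> + c * (delta P * psi P a)
      + ((c * phi P e' - e') + (\<gamma> * gain P m' - m'))) + ln (mgf k_hat))" for e' m'
    unfolding J2_eq k_hat_eq by (simp add: op_cost_def algebra_simps flip: c_def)
  then have J: "J2 P \<alpha> (beta_hat P) \<gamma> e' m' a \<le> J2 P \<alpha> (beta_hat P) \<gamma> e m a \<longleftrightarrow>
      (c * phi P e' - e') + (\<gamma> * gain P m' - m') \<le> (c * phi P e - e) + (\<gamma> * gain P m - m)" for e' m'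
    using risk_pos by simp
  have "?lhs \<longleftrightarrow> (\<forall>e'\<ge>0. \<forall>m'\<ge>0.
      (c * phi P e' - e') + (\<gamma> * gain P m' - m') \<le> (c * phi P e - e) + (\<gamma> * gain P m - m))"
    using assms by (auto simp: is_arg_max_linorder J)
  also have "\<dots> \<longleftrightarrow> (\<forall>e'\<ge>0. c * phi P e' - e' \<le> c * phi P e - e) \<and>
      (\<forall>m'\<ge>0. \<gamma> * gain P m' - m' \<le> \<gamma> * gain P m - m)"
    (is "?joint \<longleftrightarrow> ?sep")
  proof
    assume ?joint
    with assms show ?sep by (metis add_le_cancel_left add_le_cancel_right)
  qed (simp add: add_mono)
  also have "\<dots> \<longleftrightarrow> c = phi.slope_inv e \<and> \<gamma> = gain.slope_inv m"
    using assms \<open>0 \<le> c\<close> by (simp add: phi.maximizer_iff gain.maximizer_iff)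
  \<comment> \<open>\<open>phi.slope_inv\<close> is strictly increasing, so the value
    \<open>1 - beta_hat P\<close> is taken only at \<open>e_hat P\<close>.\<close>
  also have "c = phi.slope_inv e \<longleftrightarrow> e = e_hat P"
    unfolding c_def slope_inv_e_hat[symmetric]
    using phi.slope_inv_strict_mono[of e "e_hat P"] phi.slope_inv_strict_mono[of "e_hat P" e]
      e_hat_pos assms by (cases e "e_hat P" rule: linorder_cases) simp_all
  finally show ?thesis by (simp add: gamma_hat_eq)
qed

text \<open>For each \<open>a'\<close> the bound \<open>best_I e m a'\<close> is attained, so the
  joint problem reduces to maximising it over \<open>a'\<close>; \<alpha> and \<gamma> are
  constrained only through their total transfer.\<close>

lemma best_response_I:
  assumes "0 \<le> e" "0 \<le> m"
  shows "is_arg_max (\<lambda>(a', \<alpha>', \<beta>', \<gamma>'). I2 P \<alpha>' \<beta>' \<gamma>' e m a')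
      (\<lambda>(a', \<alpha>', \<beta>', \<gamma>'). 0 \<le> a' \<and> 0 \<le> \<alpha>' \<and> 0 \<le> \<gamma>' \<and> V_of P 0 \<le> J2 P \<alpha>' \<beta>' \<gamma>' e m a')
      (a, \<alpha>, \<beta>, \<gamma>)
    \<longleftrightarrow> 0 \<le> a \<and> 0 \<le> \<alpha> \<and> 0 \<le> \<gamma> \<and> \<beta> = beta_hat P \<and> \<alpha> + \<gamma> * gain P m = transfer e m a
      \<and> (\<forall>a'\<ge>0. best_I e m a' \<le> best_I e m a)"
    (is "?lhs \<longleftrightarrow> ?rhs")
proof
  assume ?lhs
  then have feas: "0 \<le> a" "0 \<le> \<alpha>" "0 \<le> \<gamma>" "V_of P 0 \<le> J2 P \<alpha> \<beta> \<gamma> e m a"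
    and opt: "\<And>a' \<alpha>' \<beta>' \<gamma>'. 0 \<le> a' \<Longrightarrow> 0 \<le> \<alpha>' \<Longrightarrow> 0 \<le> \<gamma>' \<Longrightarrow>
      V_of P 0 \<le> J2 P \<alpha>' \<beta>' \<gamma>' e m a' \<Longrightarrow> I2 P \<alpha>' \<beta>' \<gamma>' e m a' \<le> I2 P \<alpha> \<beta> \<gamma> e m a"
    by (auto simp: is_arg_max_linorder)
  \<comment> \<open>The test deviation pays the whole transfer through \<alpha> with \<gamma> equal
    to \<open>0\<close>; it is feasible whatever the sign of \<open>gain P m\<close>.\<close>
  have ge: "best_I e m a' \<le> I2 P \<alpha> \<beta> \<gamma> e m a" if "0 \<le> a'" for a'
    using opt[of a' "transfer e m a'" 0 "beta_hat P"] transfer_pos[OF assms that]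
      I2_at_transfer[of "transfer e m a'" 0 m e a'] that by simp
  have "I2 P \<alpha> \<beta> \<gamma> e m a = best_I e m a"
    using ge[OF feas(1)] I2_le_best_I(1)[OF feas(4)] by simp
  with I2_le_best_I(2)[OF feas(4)] feas ge show ?rhs by simp
next
  assume rhs: ?rhs
  have "I2 P \<alpha>' \<beta>' \<gamma>' e m a' \<le> I2 P \<alpha> \<beta> \<gamma> e m a"
    if "0 \<le> a'" "V_of P 0 \<le> J2 P \<alpha>' \<beta>' \<gamma>' e m a'" for a' \<alpha>' \<beta>' \<gamma>'
    using I2_le_best_I(1)[OF that(2)] rhs that(1) I2_at_transfer(1)[of \<alpha> \<gamma> m e a]
    by (metis order_trans)
  with rhs show ?lhs
    using I2_at_transfer(2)[of \<alpha> \<gamma> m e a] by (auto simp: is_arg_max_linorder)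
qed

lemma optimal_a_iff:
  "optimal_a P m a \<longleftrightarrow> 0 \<le> a \<and> (\<forall>a'\<ge>0. value_I P m a' \<le> value_I P m a)"
  by (auto simp: optimal_a_def is_arg_max_linorder)

text \<open>Firm I's condition comes first: it fixes \<beta> at \<open>beta_hat P\<close>, which
  \<open>best_response_J\<close> presupposes. Firm J's condition then fixes \<open>e\<close> and
  \<gamma>, and the binding transfer leaves one value for \<alpha>.\<close>

lemma nash2_iff:
  "nash2 P (\<alpha>, \<beta>, \<gamma>, e, m, a) \<longleftrightarrow>
    0 \<le> m \<and> optimal_a P m a \<and> 0 \<le> alpha_hat P m a \<and> \<alpha> = alpha_hat P m a \<and>
    \<beta> = beta_hat P \<and> \<gamma> = gamma_hat P m \<and> e = e_hat P"
    (is "?lhs \<longleftrightarrow> ?rhs")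
proof
  assume ?lhs
  then have J: "is_arg_max (\<lambda>(e', m'). J2 P \<alpha> \<beta> \<gamma> e' m' a) (\<lambda>(e', m'). 0 \<le> e' \<and> 0 \<le> m') (e, m)"
    and I: "is_arg_max (\<lambda>(a', \<alpha>', \<beta>', \<gamma>'). I2 P \<alpha>' \<beta>' \<gamma>' e m a')
      (\<lambda>(a', \<alpha>', \<beta>', \<gamma>'). 0 \<le> a' \<and> 0 \<le> \<alpha>' \<and> 0 \<le> \<gamma>' \<and> V_of P 0 \<le> J2 P \<alpha>' \<beta>' \<gamma>' e m a')
      (a, \<alpha>, \<beta>, \<gamma>)"
    unfolding nash2_def prod.case by (rule conjunct1, rule conjunct2)
  from J have em: "0 \<le> e" "0 \<le> m" by (simp_all add: is_arg_max_linorder)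
  note I' = I[unfolded best_response_I[OF em]]
  then have "0 \<le> \<gamma>" "\<beta> = beta_hat P" by simp_all
  with J have "e = e_hat P \<and> \<gamma> = gamma_hat P m"
    using best_response_J[OF \<open>0 \<le> \<gamma>\<close> em] by blast
  with I' em show ?rhs by (auto simp: optimal_a_iff value_I_eq alpha_hat_transfer)
next
  assume rhs: ?rhs
  then have m: "0 \<le> m" and e: "0 \<le> e_hat P" and \<gamma>: "0 \<le> gamma_hat P m"
    using e_hat_pos by (auto simp: gamma_hat_eq gain.slope_inv_nonneg)
  have t: "alpha_hat P m a + gamma_hat P m * gain P m = transfer (e_hat P) m a"
    using m by (simp add: alpha_hat_transfer)
  have "\<alpha> = alpha_hat P m a" "\<beta> = beta_hat P" "\<gamma> = gamma_hat P m" "e = e_hat P"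
    using rhs by simp_all
  moreover have "0 \<le> a" "\<forall>a'\<ge>0. best_I (e_hat P) m a' \<le> best_I (e_hat P) m a"
    using rhs by (auto simp: optimal_a_iff value_I_eq)
  ultimately show ?lhs
    unfolding nash2_def prod.case
    using rhs \<gamma> t best_response_J[OF \<gamma> e m] best_response_I[OF e m] by blast
qed

lemma nash2_values:
  assumes "nash2 P (\<alpha>, \<beta>, \<gamma>, e, m, a)"
  shows "0 < \<alpha> + \<gamma>" "J2 P \<alpha> \<beta> \<gamma> e m a = V_of P 0" "I2 P \<alpha> \<beta> \<gamma> e m a = value_I P m a"
proof -
  from assms have *: "0 \<le> m" "0 \<le> a" "0 \<le> \<alpha>" "\<alpha> = alpha_hat P m a" "\<beta> = beta_hat P"
      "\<gamma> = gamma_hat P m" "e = e_hat P"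
    by (simp_all add: nash2_iff optimal_a_iff)
  have t: "\<alpha> + \<gamma> * gain P m = transfer e m a" using * by (simp add: alpha_hat_transfer)
  show "J2 P \<alpha> \<beta> \<gamma> e m a = V_of P 0" "I2 P \<alpha> \<beta> \<gamma> e m a = value_I P m a"
    using I2_at_transfer[OF t] * by (simp_all add: value_I_eq)
  show "0 < \<alpha> + \<gamma>"
  \<comment> \<open>At \<open>m = 0\<close> the multiplier \<gamma> vanishes and \<alpha> must carry
    the positive transfer; otherwise \<gamma> itself is positive.\<close>
  proof (cases "m = 0")
    case True
    then have "\<gamma> = 0" using * by (simp add: gamma_hat_eq)
    with t transfer_pos[of e m a] * e_hat_pos show ?thesis by simp
  next
    case False
    then show ?thesis using * gain.slope_inv_pos[of m] by (simp add: gamma_hat_eq)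
  qed
qed

section \<open>The function G\<close>

lemma m_zero_nonneg: "0 \<le> m_zero P"
  using gain_pos by (auto simp: m_zero_def intro!: cInf_greatest)

lemma gain_pos_above:
  assumes "m_zero P < m"
  shows "0 < gain P m"
proof -
  have "{m. 0 < m \<and> 0 < gain P m} \<noteq> {}" using gain_pos by auto
  from cInf_lessD[OF this assms[unfolded m_zero_def]]
  obtain n where "0 < n" "0 < gain P n" "n < m" by auto
  then show ?thesis using gain.strict_mono[of n m] by simp
qed

lemma gain_nonpos_below:
  assumes "0 < m" "m < m_zero P"
  shows "gain P m \<le> 0"
proof (rule ccontr)
  assume "\<not> gain P m \<le> 0"
  with assms have "m \<in> {m. 0 < m \<and> 0 < gain P m}" by simp
  moreover have "bdd_below {m. 0 < m \<and> 0 < gain P m}" by (rule bdd_belowI[of _ 0]) simp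
  ultimately have "m_zero P \<le> m" unfolding m_zero_def by (rule cInf_lower)
  with assms show False by simp
qed

text \<open>Only a right limit is taken, since \<open>m_zero P\<close> may be \<open>0\<close>,
  where \<open>gain P\<close> is known to be continuous from the right only.\<close>

lemma gain_m_zero_nonneg: "0 \<le> gain P (m_zero P)"
proof (rule tendsto_lowerbound)
  have "continuous (at (m_zero P) within {0..}) (gain P)"
    using gain.continuous m_zero_nonneg by (simp add: continuous_on_eq_continuous_within)
  then have "continuous (at_right (m_zero P)) (gain P)"
    by (rule continuous_within_subset) (use m_zero_nonneg in auto)
  then show "(gain P \<longlongrightarrow> gain P (m_zero P)) (at_right (m_zero P))"
    by (simp add: continuous_within)
  show "\<forall>\<^sub>F m in at_right (m_zero P). 0 \<le> gain P m"
    using eventually_at_right_less by eventually_elim (use gain_pos_above in force)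
qed simp

text \<open>Positivity of \<open>m_zero P\<close> provides points on its left; if
  \<open>m_zero P = 0\<close>, the value \<open>gain P 0\<close> may be positive.\<close>

lemma gain_m_zero_nonpos:
  assumes "0 < m_zero P"
  shows "gain P (m_zero P) \<le> 0"
proof (rule tendsto_upperbound)
  have "isCont (gain P) (m_zero P)"
    using gain.has_deriv[OF assms] by (rule DERIV_isCont)
  then show "(gain P \<longlongrightarrow> gain P (m_zero P)) (at_left (m_zero P))"
    by (simp add: isCont_def filterlim_at_split)
  show "\<forall>\<^sub>F m in at_left (m_zero P). gain P m \<le> 0"
    using eventually_at_left_real[OF assms] by eventually_elim (use gain_nonpos_below in auto)
qed simp

lemma G_of_0 [simp]: "G_of P 0 = 0"
  by (simp add: G_of_eq)

lemma G_of_nonpos: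
  assumes "0 \<le> m" "m \<le> m_zero P"
  shows "G_of P m \<le> 0"
proof (cases "m = 0")
  case False
  with assms have "gain P m \<le> 0"
    using gain_nonpos_below[of m] gain_m_zero_nonpos by (cases "m = m_zero P") auto
  then have "gain.slope_inv m * gain P m \<le> 0"
    using gain.slope_inv_nonneg[OF assms(1)] by (intro mult_nonneg_nonpos)
  with assms(1) show ?thesis by (simp add: G_of_eq)
qed simp

text \<open>The increase has two sources: a larger multiplier on a nonnegative gain, and the fact
  that \<open>n\<close> maximises the objective for its own multiplier.\<close>

lemma G_of_mono:
  assumes "m_zero P \<le> m" "m \<le> n"
  shows "G_of P m \<le> G_of P n"
proof (cases "m = n")
  case False
  have m: "0 \<le> m" using assms m_zero_nonneg by simp
  have "0 \<le> gain P m"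
    using assms(1) gain_m_zero_nonneg gain_pos_above[of m] by (cases "m = m_zero P") auto
  then have "gain.slope_inv m * gain P m \<le> gain.slope_inv n * gain P m"
    using gain.slope_inv_strict_mono[OF m, of n] assms False by (intro mult_right_mono) auto
  moreover have "gain.slope_inv n * gain P m - m < gain.slope_inv n * gain P n - n"
    using False m assms by (intro gain.maximizer_unique) auto
  ultimately show ?thesis using m assms by (simp add: G_of_eq)
qed simp

text \<open>Intermediate value theorem from \<open>m_zero P\<close> upwards. Large values come from
  testing the maximiser \<open>t\<close> against a fixed point \<open>n\<close> of positive gain:
  \<open>G_of P t\<close> is at least \<open>gain.slope_inv t * gain P n - n\<close>.\<close>

lemma G_of_surj:
  assumes "0 \<le> y"
  shows "y \<in> G_of P ` {m_zero P..}"
proof -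
  define n where "n = m_zero P + 1"
  have n: "0 < n" "0 < gain P n" using m_zero_nonneg by (simp_all add: n_def gain_pos_above)
  obtain s where s: "\<And>t. s \<le> t \<Longrightarrow> (y + n) / gain P n < gain.slope_inv t"
    using gain.slope_inv_large by blast
  define t where "t = max s n"
  have t: "0 \<le> t" "n \<le> t" "s \<le> t" using n by (auto simp: t_def)
  have "y + n < gain.slope_inv t * gain P n"
    using s[OF t(3)] n by (simp add: divide_less_eq)
  moreover have "gain.slope_inv t * gain P n - n \<le> gain.slope_inv t * gain P t - t"
    using gain.maximizer_unique[of t n] t n by (cases "t = n") auto
  ultimately have "y \<le> G_of P t" using t by (simp add: G_of_eq)
  moreover have "G_of P (m_zero P) \<le> y"
    using G_of_nonpos[OF m_zero_nonneg order_refl] assms by simp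
  moreover have "continuous_on {m_zero P..t} (G_of P)"
  proof (rule continuous_on_eq)
    show "continuous_on {m_zero P..t} (\<lambda>m. gain.slope_inv m * gain P m - m)"
      using m_zero_nonneg
      by (intro continuous_intros continuous_on_subset[OF gain.continuous_slope_inv]
          continuous_on_subset[OF gain.continuous]) auto
  qed (use m_zero_nonneg in \<open>simp add: G_of_eq\<close>)
  ultimately obtain x where "m_zero P \<le> x" "G_of P x = y"
    using IVT'[of "G_of P" "m_zero P" y t] t by (auto simp: n_def)
  then show ?thesis by auto
qed

lemma G_inv:
  assumes "0 \<le> y"
  shows "m_zero P \<le> G_inv P y" "G_of P (G_inv P y) = y"
  using inv_into_into[OF G_of_surj[OF assms]] f_inv_into_f[OF G_of_surj[OF assms]]
  by (simp_all add: G_inv_def)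

text \<open>Monotonicity is available only from \<open>m_zero P\<close> on; below that point the
  sign of \<open>G_of P m\<close> settles the bound.\<close>

lemma G_of_le:
  assumes "0 \<le> m" "m \<le> G_inv P y" "0 \<le> y"
  shows "G_of P m \<le> y"
  using G_of_mono[of m "G_inv P y"] G_inv[OF assms(3)] G_of_nonpos[of m] assms
  by (cases "m_zero P \<le> m") auto

text \<open>The transfer net of \<open>m\<close> exceeds \<open>e_hat P\<close>, and that is the
  room which \<open>G_of P m\<close> may use up.\<close>

lemma alpha_hat_nonneg:
  assumes "0 \<le> m" "m \<le> G_inv P (e_hat P)" "0 \<le> a"
  shows "0 \<le> alpha_hat P m a"
proof -
  have "e_hat P < transfer (e_hat P) m a - m"
    using transfer_gt[of "e_hat P" a m] e_hat_pos assms by simp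
  then show ?thesis
    using G_of_le[OF assms(1,2)] e_hat_pos alpha_hat_eq[of m a] by simp
qed

section \<open>The choice of a\<close>

lemma B_of_pos: "0 < B_of P m"
  by (simp add: B_of_def Let_def)

section \<open>Growth of the financing cost and existence of an optimal \<open>a\<close>\<close>

lemma fin_cost_has_deriv:
  assumes "0 < x"
  shows "(fin_cost P has_real_derivative deriv (fin_cost P) x) (at x)"
proof -
  have "fin_cost P differentiable (at x within {0..})"
    using fin_cost_differentiable assms by (simp add: differentiable_on_def)
  moreover have "at x within {0..} = at x" using assms by (intro at_within_interior) simp
  ultimately show ?thesis by (simp add: DERIV_deriv_iff_real_differentiable)
qed

text \<open>A convex function lies above its tangent, taken here where the slope exceeds
  \<open>1\<close>. Linear growth is enough because \<open>ben_a P\<close> is bounded.\<close>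

lemma fin_cost_linear_growth: "\<exists>x0>0. \<forall>y\<ge>x0. fin_cost P x0 + (y - x0) \<le> fin_cost P y"
proof -
  have "\<forall>\<^sub>F x in at_top. ereal 1 < ederiv (fin_cost P) x"
    using fin_cost_deriv_infty unfolding tendsto_PInfty by blast
  then have "\<forall>\<^sub>F x in at_top. 0 < x \<and> ereal 1 < ederiv (fin_cost P) x"
    using eventually_gt_at_top[of 0] by eventually_elim simp
  then obtain x0 where "0 < x0" "ereal 1 < ederiv (fin_cost P) x0"
    by (auto dest!: eventually_happens)
  then have x0: "0 < x0" "1 < deriv (fin_cost P) x0" by (simp_all add: ederiv_def)
  have "fin_cost P x0 + (y - x0) \<le> fin_cost P y" if "x0 \<le> y" for y
  proof -
    have "deriv (fin_cost P) x0 * (y - x0) \<le> fin_cost P y - fin_cost P x0"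
    proof (rule convex_on_imp_above_tangent)
      show "convex_on {0..} (fin_cost P)"
        by (rule strictly_convex_on_imp_convex_on[OF fin_cost_convex])
      show "(fin_cost P has_real_derivative deriv (fin_cost P) x0) (at x0 within {0..})"
        by (rule has_field_derivative_at_within[OF fin_cost_has_deriv[OF x0(1)]])
    qed (use x0 that in \<open>simp_all add: convex_connected convex_real_interval\<close>)
    moreover have "1 * (y - x0) \<le> deriv (fin_cost P) x0 * (y - x0)"
      using x0 that by (intro mult_right_mono) auto
    ultimately show ?thesis by simp
  qed
  with x0(1) show ?thesis by blast
qed

lemma debt_arg_pos: "0 \<le> a \<Longrightarrow> 0 < (1 + rate P) * (debt P + a)"
  using rate_nonneg debt_pos by simp

lemma continuous_F_of: "continuous_on {0..} (F_of P)"
proof -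
  have "continuous_on {0..} (ben_a P)" using ben_a_C1 by (simp add: C1_half_line_def)
  moreover have "continuous_on {0..} (\<lambda>a. fin_cost P ((1 + rate P) * (debt P + a)))"
    using debt_arg_pos
    by (intro continuous_on_compose2[OF differentiable_imp_continuous_on[OF fin_cost_differentiable]]
        continuous_intros) (auto intro: less_imp_le)
  ultimately show ?thesis unfolding F_of_def by (rule continuous_on_diff)
qed

lemma continuous_value_I: "continuous_on {0..} (value_I P m)"
  unfolding value_I_def by (intro continuous_intros continuous_F_of psi.continuous)

lemma F_of_coercive: "\<exists>R\<ge>0. \<forall>a>R. F_of P a < c"
proof -
  obtain K where K: "\<And>a. 0 \<le> a \<Longrightarrow> ben_a P a \<le> K"
  proof (cases "at_infty (ben_a P)")
    case (real r)
    then show ?thesis using that mono_le_at_infty[OF ben_a_mono] by auto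
  next
    case PInf
    then show ?thesis using ben_a_bounded by simp
  next
    case MInf
    then show ?thesis using mono_le_at_infty[OF ben_a_mono, of 0] by simp
  qed
  obtain x0 where x0: "x0 > 0" "\<And>y. x0 \<le> y \<Longrightarrow> fin_cost P x0 + (y - x0) \<le> fin_cost P y"
    using fin_cost_linear_growth by blast
  \<comment> \<open>The second entry makes the linear bound push
    \<open>K - fin_cost P x0 - (a - x0)\<close> below \<open>c\<close>; the first keeps
    \<open>a\<close> where that bound is valid.\<close>
  define R where "R = max x0 (K - c - fin_cost P x0 + x0)"
  have "F_of P a < c" if "R < a" for a
  proof -
    have a: "x0 \<le> a" "0 \<le> a" "K - c - fin_cost P x0 + x0 < a"
      using that x0(1) by (auto simp: R_def)
    have "a \<le> debt P + a" using debt_pos by simp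
    also have "\<dots> \<le> (1 + rate P) * (debt P + a)"
      using rate_nonneg debt_pos a by (simp add: mult_le_cancel_right1)
    finally have y: "a \<le> (1 + rate P) * (debt P + a)" .
    show ?thesis
      using x0(2)[of "(1 + rate P) * (debt P + a)"] y a K[of a] by (simp add: F_of_def)
  qed
  moreover have "0 \<le> R" using x0(1) by (simp add: R_def le_max_iff_disj)
  ultimately show ?thesis by blast
qed

text \<open>Beyond \<open>R\<close> even \<open>F_of P\<close>, an upper bound of
  \<open>value_I P m\<close>, falls below the value at \<open>0\<close>, so a maximum over
  \<open>{0..R}\<close> is global. This works for either sign of \<open>delta P\<close>.\<close>

lemma optimal_a_exists: "\<exists>a. optimal_a P m a"
proof -
  obtain R where R: "0 \<le> R" "\<And>a. R < a \<Longrightarrow> F_of P a < value_I P m 0"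
    using F_of_coercive by blast
  have "continuous_on {0..R} (value_I P m)"
    by (rule continuous_on_subset[OF continuous_value_I]) auto
  then obtain a where a: "a \<in> {0..R}" "\<And>b. b \<in> {0..R} \<Longrightarrow> value_I P m b \<le> value_I P m a"
    using continuous_attains_sup[of "{0..R}" "value_I P m"] R(1) by auto
  have "value_I P m b \<le> value_I P m a" if "0 \<le> b" for b
  proof (cases "b \<le> R")
    case True
    then show ?thesis using a(2)[of b] that by simp
  next
    case False
    have "value_I P m b \<le> F_of P b" using B_of_pos[of m] by (simp add: value_I_def)
    also have "\<dots> < value_I P m 0" using False R(2) by simp
    also have "\<dots> \<le> value_I P m a" using a(2)[of 0] R(1) by simp
    finally show ?thesis by simp
  qed
  then show ?thesis using a(1) by (auto simp: optimal_a_iff)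
qed

section \<open>Uniqueness and positivity of the optimal \<open>a\<close> for nonnegative
  \<open>delta P\<close>\<close>

lemma F_of_midpoint:
  assumes "0 \<le> a" "0 \<le> b" "a \<noteq> b"
  shows "(F_of P a + F_of P b) / 2 < F_of P ((a + b) / 2)"
proof -
  let ?l = "\<lambda>a. (1 + rate P) * (debt P + a)"
  have "?l a \<noteq> ?l b" using assms rate_nonneg by simp
  then have f: "fin_cost P ((1 - 1/2) * ?l a + 1/2 * ?l b)
      < (1 - 1/2) * fin_cost P (?l a) + 1/2 * fin_cost P (?l b)"
    using debt_arg_pos[of a] debt_arg_pos[of b] assms
    by (intro strictly_convex_onD[OF fin_cost_convex]) auto
  have l: "(1 - 1/2) * ?l a + 1/2 * ?l b = ?l ((a + b) / 2)" by (simp add: field_simps)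
  have b: "(1 - 1/2) * ben_a P a + 1/2 * ben_a P b \<le> ben_a P ((1 - 1/2) *\<^sub>R a + (1/2) *\<^sub>R b)"
    using ben_a_concave assms by (intro concave_onD) auto
  have mid: "(1 - 1/2) *\<^sub>R a + (1/2) *\<^sub>R b = (a + b) / 2" by (simp add: field_simps)
  show ?thesis using f[unfolded l] b[unfolded mid] by (simp add: F_of_def)
qed

text \<open>A convex nonincreasing exponential composed with the concave \<open>psi P\<close> is
  convex; the sign of \<open>delta P\<close> decides the monotonicity.\<close>

lemma exp_psi_midpoint:
  assumes "0 \<le> delta P" "0 \<le> a" "0 \<le> b"
  shows "exp (- u * delta P * psi P ((a + b) / 2))
    \<le> (exp (- u * delta P * psi P a) + exp (- u * delta P * psi P b)) / 2"
proof -
  define c where "c = u * delta P"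
  have "0 \<le> c" using assms risk_pos by (simp add: c_def)
  have psi: "- psi P ((1 - 1/2) *\<^sub>R a + (1/2) *\<^sub>R b) \<le> (1 - 1/2) * - psi P a + 1/2 * - psi P b"
    using assms by (intro convex_onD[OF psi.convex_neg]) auto
  have mid: "(1 - 1/2) *\<^sub>R a + (1/2) *\<^sub>R b = (a + b) / 2" by (simp add: field_simps)
  from psi[unfolded mid] have "(psi P a + psi P b) / 2 \<le> psi P ((a + b) / 2)" by simp
  then have "c * ((psi P a + psi P b) / 2) \<le> c * psi P ((a + b) / 2)"
    using \<open>0 \<le> c\<close> by (rule mult_left_mono)
  then have "exp (- c * psi P ((a + b) / 2)) \<le> exp (1/2 * (- c * psi P a) + (1 - 1/2) * (- c * psi P b))"
    by (simp add: field_simps)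
  also have "\<dots> \<le> 1/2 * exp (- c * psi P a) + (1 - 1/2) * exp (- c * psi P b)"
    using exp_weighted_less[of "- c * psi P a" "- c * psi P b" "1/2"]
    by (cases "- c * psi P a = - c * psi P b") (simp_all only:, simp_all)
  finally show ?thesis by (simp add: c_def)
qed

text \<open>The midpoint of two distinct maximisers would do strictly better, the strictness coming
  from \<open>F_of P\<close>.\<close>

lemma optimal_a_unique:
  assumes "0 \<le> delta P" "optimal_a P m a" "optimal_a P m b"
  shows "a = b"
proof (rule ccontr)
  assume "a \<noteq> b"
  have ab: "0 \<le> a" "0 \<le> b" "value_I P m a = value_I P m b"
    and le: "value_I P m ((a + b) / 2) \<le> value_I P m a"
    using assms by (auto simp: optimal_a_iff intro: order_antisym)
  have "(value_I P m a + value_I P m b) / 2 = (F_of P a + F_of P b) / 2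
      - (exp (- u * delta P * psi P a) + exp (- u * delta P * psi P b)) / 2 * B_of P m"
    by (simp add: value_I_def field_simps)
  also have "\<dots> < F_of P ((a + b) / 2) - exp (- u * delta P * psi P ((a + b) / 2)) * B_of P m"
    using F_of_midpoint[OF ab(1,2) \<open>a \<noteq> b\<close>] B_of_pos[of m]
      mult_right_mono[OF exp_psi_midpoint[OF assms(1) ab(1,2)], of "B_of P m"] by linarith
  also have "\<dots> = value_I P m ((a + b) / 2)" by (simp add: value_I_def)
  finally show False using ab(3) le by simp
qed

text \<open>\<open>F_deriv_0\<close> speaks of a \<open>Lim\<close>, so convergence of the quotient
  comes first. The part from \<open>ben_a P\<close> converges, perhaps to infinity; the part from
  \<open>fin_cost P\<close> has a finite limit since \<open>x0\<close> is positive, so the limits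
  add in \<open>ereal\<close>.\<close>

lemma F_of_increase: "\<exists>t>0. F_of P 0 < F_of P t"
proof -
  define x0 where "x0 = (1 + rate P) * debt P"
  have "0 < x0" using debt_arg_pos[of 0] by (simp add: x0_def)
  obtain d where d: "((\<lambda>t. ereal ((ben_a P t - ben_a P 0) / t)) \<longlongrightarrow> d) (at_right 0)"
    using ben_a_C1 by (auto simp: C1_half_line_def)
  have "((\<lambda>t. fin_cost P (x0 + (1 + rate P) * t)) has_real_derivative
      deriv (fin_cost P) x0 * (1 + rate P)) (at 0)"
    by (rule DERIV_chain'[where g = "fin_cost P"])
       (use fin_cost_has_deriv[OF \<open>0 < x0\<close>] in \<open>auto intro!: derivative_eq_intros\<close>)
  then have "((\<lambda>t. (fin_cost P (x0 + (1 + rate P) * t) - fin_cost P x0) / t) \<longlongrightarrow>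
      deriv (fin_cost P) x0 * (1 + rate P)) (at 0)"
    by (simp add: DERIV_def)
  then have "((\<lambda>t. - ((fin_cost P (x0 + (1 + rate P) * t) - fin_cost P x0) / t)) \<longlongrightarrow>
      - (deriv (fin_cost P) x0 * (1 + rate P))) (at_right 0)"
    by (intro tendsto_minus) (simp add: filterlim_at_split)
  then have "((\<lambda>t. ereal ((ben_a P t - ben_a P 0) / t)
        + ereal (- ((fin_cost P (x0 + (1 + rate P) * t) - fin_cost P x0) / t)))
      \<longlongrightarrow> d + ereal (- (deriv (fin_cost P) x0 * (1 + rate P)))) (at_right 0)"
    using d by (intro tendsto_add_ereal_general1) (simp_all only: lim_ereal, simp)
  moreover have "ereal ((ben_a P t - ben_a P 0) / t)
      + ereal (- ((fin_cost P (x0 + (1 + rate P) * t) - fin_cost P x0) / t))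
      = ereal ((F_of P t - F_of P 0) / t)" for t
    by (simp add: F_of_def x0_def diff_divide_distrib distrib_left)
  ultimately have lim: "((\<lambda>t. ereal ((F_of P t - F_of P 0) / t))
      \<longlongrightarrow> d + ereal (- (deriv (fin_cost P) x0 * (1 + rate P)))) (at_right 0)"
    by simp
  then have eq: "ederiv (F_of P) 0 = d + ereal (- (deriv (fin_cost P) x0 * (1 + rate P)))"
    unfolding ederiv_def using tendsto_Lim[OF trivial_limit_at_right_real] by simp
  have "\<forall>\<^sub>F t in at_right 0. 0 < ereal ((F_of P t - F_of P 0) / t)"
    using order_tendstoD(1)[OF lim F_deriv_0[unfolded eq]] .
  then have "\<forall>\<^sub>F t in at_right 0. 0 < t \<and> 0 < ereal ((F_of P t - F_of P 0) / t)"
    using eventually_at_right_less[of 0] by eventually_elim simp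
  then obtain t where "0 < t" "0 < ereal ((F_of P t - F_of P 0) / t)"
    using eventually_happens'[OF trivial_limit_at_right_real] by blast
  then show ?thesis by (intro exI[of _ t]) (simp add: zero_less_divide_iff)
qed

lemma optimal_a_pos:
  assumes "0 \<le> delta P" "optimal_a P m a"
  shows "0 < a"
proof (rule ccontr)
  assume "\<not> 0 < a"
  with assms(2) have "a = 0" by (simp add: optimal_a_iff)
  obtain t where t: "0 < t" "F_of P 0 < F_of P t" using F_of_increase by blast
  have "u * delta P * psi P 0 \<le> u * delta P * psi P t"
    using psi.strict_mono[of 0 t] t assms(1) risk_pos by (intro mult_left_mono) auto
  then have "exp (- u * delta P * psi P t) * B_of P m \<le> exp (- u * delta P * psi P 0) * B_of P m"
    using B_of_pos[of m] by (intro mult_right_mono) auto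
  with t have "value_I P m 0 < value_I P m t" by (simp add: value_I_def)
  with assms(2) t \<open>a = 0\<close> show False by (auto simp: optimal_a_iff not_le[symmetric])
qed

text \<open>The \<open>m\<close> components of the equilibria cover the interval from
  \<open>0\<close> to \<open>G_inv P (e_hat P)\<close>, nondegenerate because \<open>G_of P\<close>
  vanishes at \<open>0\<close> but not at the right end.\<close>

lemma infinite_nash2: "infinite {x. nash2 P x}"
proof
  assume "finite {x. nash2 P x}"
  then have fin: "finite ((\<lambda>(\<alpha>, \<beta>, \<gamma>, e, m, a). m) ` {x. nash2 P x})" by (rule finite_imageI)
  have "G_inv P (e_hat P) \<noteq> 0" using G_inv(2)[of "e_hat P"] e_hat_pos G_of_0 by force
  then have n: "0 < G_inv P (e_hat P)"
    using G_inv(1)[of "e_hat P"] e_hat_pos m_zero_nonneg by simp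
  have "{0..G_inv P (e_hat P)} \<subseteq> (\<lambda>(\<alpha>, \<beta>, \<gamma>, e, m, a). m) ` {x. nash2 P x}"
  proof
    fix m assume m: "m \<in> {0..G_inv P (e_hat P)}"
    obtain a where a: "optimal_a P m a" using optimal_a_exists by blast
    then have "0 \<le> alpha_hat P m a"
      using m by (intro alpha_hat_nonneg) (auto simp: optimal_a_iff)
    with m a have "nash2 P (alpha_hat P m a, beta_hat P, gamma_hat P m, e_hat P, m, a)"
      by (simp add: nash2_iff)
    then show "m \<in> (\<lambda>(\<alpha>, \<beta>, \<gamma>, e, m, a). m) ` {x. nash2 P x}" by (intro rev_image_eqI) auto
  qed
  then have "finite {0..G_inv P (e_hat P)}" using fin by (rule finite_subset)
  then show False using n infinite_Icc by blast
qed

lemma nash2_set_eq: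
  "{x. nash2 P x} = {(alpha_hat P m a, beta_hat P, gamma_hat P m, e_hat P, m, a) | m a.
     0 \<le> m \<and> optimal_a P m a \<and> 0 \<le> alpha_hat P m a}"
proof (intro set_eqI)
  fix x :: "real \<times> real \<times> real \<times> real \<times> real \<times> real"
  obtain \<alpha> \<beta> \<gamma> e m a where x: "x = (\<alpha>, \<beta>, \<gamma>, e, m, a)" by (cases x) auto
  show "x \<in> {x. nash2 P x} \<longleftrightarrow>
      x \<in> {(alpha_hat P m a, beta_hat P, gamma_hat P m, e_hat P, m, a) | m a.
        0 \<le> m \<and> optimal_a P m a \<and> 0 \<le> alpha_hat P m a}"
    unfolding x mem_Collect_eq nash2_iff prod.inject by blast
qed

end

theorem theorem2:
  fixes P :: "'w model"
  assumes "outsourcing P"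
  shows "infinite {x. nash2 P x}
    \<and> {x. nash2 P x} =
        {(alpha_hat P m a, beta_hat P, gamma_hat P m, e_hat P, m, a) | m a.
           0 \<le> m \<and> optimal_a P m a \<and> 0 \<le> alpha_hat P m a}
    \<and> (\<forall>m a. 0 \<le> m \<and> m \<le> G_inv P (e_hat P) \<and> optimal_a P m a \<longrightarrow> 0 \<le> alpha_hat P m a)
    \<and> (\<forall>\<alpha> \<beta> \<gamma> e m a. nash2 P (\<alpha>, \<beta>, \<gamma>, e, m, a) \<longrightarrow>
         0 < \<alpha> + \<gamma> \<and> J2 P \<alpha> \<beta> \<gamma> e m a = V_of P 0 \<and> I2 P \<alpha> \<beta> \<gamma> e m a = value_I P m a)
    \<and> (\<forall>m\<ge>0. \<exists>a. optimal_a P m a)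
    \<and> (0 \<le> delta P \<longrightarrow> (\<forall>m\<ge>0. (\<exists>!a. optimal_a P m a) \<and> (\<forall>a. optimal_a P m a \<longrightarrow> 0 < a)))"
proof -
  interpret outsourcing P by (rule assms)
  have "0 \<le> alpha_hat P m a" if "0 \<le> m \<and> m \<le> G_inv P (e_hat P) \<and> optimal_a P m a" for m a
    using that alpha_hat_nonneg by (simp add: optimal_a_iff)
  moreover have "\<exists>!a. optimal_a P m a" if "0 \<le> delta P" for m
    using optimal_a_exists optimal_a_unique[OF that] by blast
  ultimately show ?thesis
    using infinite_nash2 nash2_set_eq nash2_values optimal_a_exists optimal_a_pos
    by (intro conjI allI impI)
qed

end
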